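(* Let $b\ge2$ be an integer, $\boldsymbol{e}=(e_1,\dots,e_d)\in\mathbb{N}^d$, and let $\mathcal{S}=(\boldsymbol{x}_i)_{i\ge0}$ be a $(0,\boldsymbol{e},d)$-sequence in base $b$. Let $f\in L^2([0,1)^d)$ be real-valued and assume that $\partial^df/(\partial x_1\cdots\partial x_d)$ exists and is Lipschitz continuous. Let $(\tilde{\boldsymbol{x}}^{(\mathrm{C})}_i)_{i\ge0}$ be obtained from $\mathcal{S}$ by coarse scrambling, i.e. by a nested scramble with two-fold uniformity in base $(b^{e_1},\dots,b^{e_d})$. Then, for $n=b^m$, the variance $$\sigma^2_{\mathrm{C}}(n)=\operatorname{Var}\left(\frac1n\sum_{i=0}^{n-1}f(\tilde{\boldsymbol{x}}^{(\mathrm{C})}_i)\right)$$ decays as $O\bigl(n^{-3}(\log n)^{d-1}\bigr)$ (as $m\to\infty$).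
   Context: $\mathbb{N}$ is the set of positive integers, $\mathbb{N}_0=\mathbb{N}\cup\{0\}$, $\mathbb{Z}_c=\{0,\dots,c-1\}$. For $\boldsymbol{k}\in\mathbb{N}_0^d$, an elementary $(k_1,\dots,k_d)$-interval in base $(b_1,\dots,b_d)$ is a set $\prod_{j=1}^d[a_jb_j^{-k_j},(a_j+1)b_j^{-k_j})$ with integers $0\le a_j<b_j^{k_j}$. A sequence $(\boldsymbol{x}_i)_{i\ge0}$ in $[0,1)^d$ is a $(0,\boldsymbol{e},d)$-sequence in base $b$ if for all $m,r\in\mathbb{N}_0$ and all $\boldsymbol{k}\in\mathbb{N}_0^d$ with $e_1k_1+\cdots+e_dk_d=m$, every elementary $(k_1,\dots,k_d)$-interval in base $(b^{e_1},\dots,b^{e_d})$ contains exactly one of the points $\boldsymbol{x}_{rb^m},\dots,\boldsymbol{x}_{(r+1)b^m-1}$. Nested scramble: a nested scramble in base $c\ge2$ is a random map sending $x=\sum_{k\ge1}\xi_kc^{-k}$ ($\xi_k\in\mathbb{Z}_c$) to $y=\sum_{k\ge1}\eta_kc^{-k}$ with $\eta_1=\pi(\xi_1)$ and $\eta_k=\pi_{\xi_1\cdots\xi_{k-1}}(\xi_k)$ for $k\ge2$, where $\pi$ and all $\pi_{\xi_1\cdots\xi_{k-1}}$ are mutually independent random permutations of $\mathbb{Z}_c$. A nested scramble in base $(b_1,\dots,b_d)$ applies to the $j$th coordinate, independently over $j$, a nested scramble in base $b_j$; the same random map is applied to all points of the sequence. It has two-fold uniformity if each constituent random permutation $\pi$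 of $\mathbb{Z}_c$ is such that for any $x\ne y$ in $\mathbb{Z}_c$ the pair $(\pi(x),\pi(y))$ is uniformly distributed on $\{(p,q)\in\mathbb{Z}_c\times\mathbb{Z}_c:p\ne q\}$.
   Formalization: For d ≥ 2 the formal theorem also assumes that every mixed partial derivative of f in a nonempty proper subset of the variables exists and is bounded on [0,1)^d; without this the claim fails, e.g. for f = (1−x_1)^(-1/4) with d = 2. *)

theory Defs
  imports
    "HOL-Analysis.Analysis"
    "HOL-Probability.Probability"
    "HOL-Combinatorics.Permutations"
    "HOL-Library.Landau_Symbols"
begin

definition unit_cube :: "(real ^ 'n) set" where
  "unit_cube = {x. \<forall>j. 0 \<le> x $ j \<and> x $ j < 1}"


subsection \<open>Digital sequences\<close>

definition elementary_interval ::
    "('n \<Rightarrow> nat) \<Rightarrow> ('n \<Rightarrow> nat) \<Rightarrow> ('n \<Rightarrow> nat) \<Rightarrow> (real ^ 'n) set" where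
  "elementary_interval c k a =
     {x. \<forall>j. real (a j) / real (c j) ^ k j \<le> x $ j \<and> x $ j < (real (a j) + 1) / real (c j) ^ k j}"

text \<open>Points are counted with their index, so repetitions count with multiplicity.\<close>

definition zero_e_sequence :: "nat \<Rightarrow> ('n::finite \<Rightarrow> nat) \<Rightarrow> (nat \<Rightarrow> real ^ 'n) \<Rightarrow> bool" where
  "zero_e_sequence b e x \<longleftrightarrow>
     (\<forall>i. x i \<in> unit_cube) \<and>
     (\<forall>m r k a. (\<Sum>j\<in>UNIV. e j * k j) = m \<longrightarrow> (\<forall>j. a j < (b ^ e j) ^ k j) \<longrightarrow>
        (\<exists>!i. i \<in> {r * b ^ m..<(r + 1) * b ^ m} \<and>
              x i \<in> elementary_interval (\<lambda>j. b ^ e j) k a))"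


subsection \<open>Nested scrambling\<close>

text \<open>The digit of index \<open>k \<ge> 1\<close> of \<open>x\<close>; for a \<open>c\<close>-adic rational this is the terminating expansion.\<close>

definition digit :: "nat \<Rightarrow> nat \<Rightarrow> real \<Rightarrow> nat" where
  "digit c k x = nat (\<lfloor>x * real c ^ k\<rfloor> mod int c)"

text \<open>
  A family \<open>p\<close> of permutations indexed by digit strings: \<open>p []\<close> acts on the first digit and
  \<open>p [\<xi>\<^sub>1, \<dots>, \<xi>\<^sub>k]\<close> acts on the digit of index \<open>k + 1\<close> of the numbers whose expansion
  starts with \<open>\<xi>\<^sub>1, \<dots>, \<xi>\<^sub>k\<close>.
\<close>

definition nested_map :: "nat \<Rightarrow> (nat list \<Rightarrow> nat \<Rightarrow> nat) \<Rightarrow> real \<Rightarrow> real" where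
  "nested_map c p x =
     (\<Sum>k. real (p (map (\<lambda>i. digit c i x) [1..<Suc k]) (digit c (Suc k) x)) / real c ^ Suc k)"

text \<open>
  \<open>P j w\<close> is the random permutation for coordinate \<open>j\<close> and digit string \<open>w\<close>. Independence within
  each coordinate together with independence over the coordinates is the mutual independence of
  the whole family; \<open>indep_vars\<close> also contains the measurability of its members.
\<close>

definition nested_scramble ::
    "'w measure \<Rightarrow> ('n \<Rightarrow> nat) \<Rightarrow> ('n \<Rightarrow> nat list \<Rightarrow> 'w \<Rightarrow> nat \<Rightarrow> nat) \<Rightarrow> bool" where
  "nested_scramble M c P \<longleftrightarrow>
     prob_space M \<and>
     prob_space.indep_vars M (\<lambda>(j, w). count_space {\<sigma>. \<sigma> permutes {..<c j}}) (\<lambda>(j, w). P j w)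
       {(j, w). set w \<subseteq> {..<c j}}"

definition two_fold_uniform ::
    "'w measure \<Rightarrow> ('n \<Rightarrow> nat) \<Rightarrow> ('n \<Rightarrow> nat list \<Rightarrow> 'w \<Rightarrow> nat \<Rightarrow> nat) \<Rightarrow> bool" where
  "two_fold_uniform M c P \<longleftrightarrow>
     (\<forall>j w x y. set w \<subseteq> {..<c j} \<longrightarrow> x < c j \<longrightarrow> y < c j \<longrightarrow> x \<noteq> y \<longrightarrow>
        distr M (count_space {(p, q). p < c j \<and> q < c j \<and> p \<noteq> q})
            (\<lambda>\<omega>. (P j w \<omega> x, P j w \<omega> y))
          = uniform_count_measure {(p, q). p < c j \<and> q < c j \<and> p \<noteq> q})"

definition scrambled_point ::
    "('n \<Rightarrow> nat) \<Rightarrow> ('n \<Rightarrow> nat list \<Rightarrow> 'w \<Rightarrow> nat \<Rightarrow> nat) \<Rightarrow> 'w \<Rightarrow> real ^ 'n \<Rightarrow> real ^ 'n" where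
  "scrambled_point c P \<omega> x = (\<chi> j. nested_map (c j) (\<lambda>w. P j w \<omega>) (x $ j))"

text \<open>
  A scrambled coordinate equals \<open>1\<close> when all its digits are \<open>c - 1\<close>. Under two-fold uniformity
  this has probability \<open>0\<close>; \<open>f\<close>, a function on \<open>[0,1)\<^sup>d\<close>, is read as \<open>0\<close> there.
\<close>

definition scrambled_mean ::
    "('n \<Rightarrow> nat) \<Rightarrow> ('n \<Rightarrow> nat list \<Rightarrow> 'w \<Rightarrow> nat \<Rightarrow> nat) \<Rightarrow> (nat \<Rightarrow> real ^ 'n) \<Rightarrow>
     (real ^ 'n \<Rightarrow> real) \<Rightarrow> nat \<Rightarrow> 'w \<Rightarrow> real" where
  "scrambled_mean c P x f n \<omega> =
     1 / real n * (\<Sum>i<n. indicator unit_cube (scrambled_point c P \<omega> (x i)) *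
                          f (scrambled_point c P \<omega> (x i)))"

definition variance_of :: "'w measure \<Rightarrow> ('w \<Rightarrow> real) \<Rightarrow> real" where
  "variance_of M X = (LINT \<omega>|M. (X \<omega> - (LINT \<omega>'|M. X \<omega>'))\<^sup>2)"


subsection \<open>Mixed partial derivatives on \<open>[0,1)\<^sup>d\<close>\<close>

text \<open>
  \<open>has_mixed_partial [j\<^sub>1, \<dots>, j\<^sub>l] f g\<close>: the iterated partial derivative of \<open>f\<close>, taken with respect
  to \<open>j\<^sub>l\<close> first and \<open>j\<^sub>1\<close> last, exists at every point of \<open>[0,1)\<^sup>d\<close> and equals \<open>g\<close> there.
  It is one-sided on the faces \<open>x\<^sub>j = 0\<close>.
\<close>

primrec has_mixed_partial ::
    "'n::finite list \<Rightarrow> (real ^ 'n \<Rightarrow> real) \<Rightarrow> (real ^ 'n \<Rightarrow> real) \<Rightarrow> bool" where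
  "has_mixed_partial [] f g \<longleftrightarrow> (\<forall>x\<in>unit_cube. g x = f x)"
| "has_mixed_partial (j # js) f g \<longleftrightarrow>
     (\<exists>h. has_mixed_partial js f h \<and>
        (\<forall>x\<in>unit_cube. ((\<lambda>t. h (\<chi> i. if i = j then t else x $ i)) has_real_derivative g x)
                         (at (x $ j) within {0..<1})))"

text \<open>
  A Lipschitz top order derivative \<open>\<partial>\<^sup>df/(\<partial>x\<^sub>1\<cdots>\<partial>x\<^sub>d)\<close> says nothing about the part of \<open>f\<close> that
  depends on fewer than \<open>d\<close> variables: for \<open>f x = (1 - x\<^sub>1) powr (- 1/4)\<close> and \<open>d \<ge> 2\<close> it vanishes
  identically, while the variance is not even \<open>o(n powr (- 3/2))\<close>. Differentiability of order one in
  each variable is therefore taken to include that the derivatives in fewer variables exist and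
  are bounded on \<open>[0,1)\<^sup>d\<close>, as they are when they extend continuously to \<open>[0,1]\<^sup>d\<close>. The condition is
  empty for \<open>d = 1\<close>.
\<close>

definition bounded_lower_partials :: "(real ^ 'n::{finite,linorder} \<Rightarrow> real) \<Rightarrow> bool" where
  "bounded_lower_partials f \<longleftrightarrow>
     (\<forall>u. u \<noteq> {} \<longrightarrow> u \<noteq> UNIV \<longrightarrow>
        (\<exists>g. has_mixed_partial (sorted_list_of_set u) f g \<and> bounded (g ` unit_cube)))"

end

theory Submission
  imports Defs
begin

text \<open>
  Approximate \<open>f\<close> by its values on the grid whose \<open>j\<close>th coordinates
  are multiples of \<open>c\<^sub>j\<^sup>-\<^sup>K\<close>, where \<open>c\<^sub>j = b\<^bsup>e j\<^esup>\<close>, and split the grid function into Haar components, one for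
  every vector \<open>k\<close> of levels (\<open>sum_components\<close>). The component of level \<open>k\<close> depends on the first
  \<open>k\<^sub>j\<close> digits of the \<open>j\<close>th coordinate and has mean zero over the last of them whenever \<open>k\<^sub>j > 0\<close>.
  Write \<open>e \<bullet> k\<close> for \<open>\<Sum>\<^sub>j e\<^sub>j k\<^sub>j\<close>, and let \<open>n = b\<^sup>m\<close>. Four facts carry the proof.

  \<^item> If \<open>k \<noteq> 0\<close> and \<open>e \<bullet> k \<le> m\<close>, every elementary interval of level \<open>k\<close> contains the same number of the
    first \<open>n\<close> points, and a scramble permutes the last digits within each coarser interval. So the mean
    of this component over the scrambled points is exactly \<open>0\<close>
    (\<open>component_mean_integrated_exactly\<close>).

  \<^item> The value of a component at a scrambled point has expectation zero against anything that does not
    involve the random permutation producing one of its last digits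
    (\<open>fresh_digit_orthogonal\<close>). Hence different levels are orthogonal, and two points interact
    at level \<open>k\<close> only if in every coordinate their first \<open>k\<^sub>j - 1\<close> digits coincide. For \<open>e \<bullet> k > m\<close> at most
    \<open>b\<^bsup>\<Sum>e\<^esup>\<close> points interact with a given one (\<open>card_close_points\<close>), so the mean of such a component
    has second moment \<open>O(n\<^sup>-\<^sup>1)\<close> times the square of a bound of the component.

  \<^item> A component of level \<open>k\<close> is an average of mixed differences of \<open>f\<close> in the variables with \<open>k\<^sub>j > 0\<close>,
    with steps of size \<open>O(c\<^sub>j\<^bsup>-k j\<^esup>)\<close>. Since the mixed derivatives of \<open>f\<close> are bounded, it is
    \<open>O(b\<^bsup>-e\<bullet>k\<^esup>)\<close> (\<open>component_bound\<close>).

  \<^item> At most \<open>(s + 1)\<^bsup>d-1\<^esup>\<close> vectors \<open>k\<close> satisfy \<open>e \<bullet> k = s\<close>. So the sum of \<open>b\<^bsup>-2 e\<bullet>k\<^esup>\<close> over all \<open>k\<close>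
    with \<open>e \<bullet> k > m\<close> is \<open>O(m\<^bsup>d-1\<^esup> b\<^bsup>-2m\<^esup>)\<close> (\<open>sum_fine_levels_bound\<close>).

  Together the grid approximation has variance \<open>O(n\<^sup>-\<^sup>1 \<sqdot> m\<^bsup>d-1\<^esup> n\<^sup>-\<^sup>2)\<close>, with a constant independent of
  \<open>K\<close>, and \<open>K \<rightarrow> \<infinity>\<close> gives the bound for \<open>f\<close>: bounded derivatives make \<open>f\<close> Lipschitz, and the
  exceptional event that a scrambled coordinate equals \<open>1\<close> is contained in events of
  probability at most \<open>c\<^sub>j\<^sup>-\<^sup>K\<close>. On a finite grid every random quantity is a function of finitely many
  permutations, so independence is used in its elementary form.
\<close>

section \<open>Digits and scrambled cells\<close>

text \<open>
  An elementary interval of level \<open>k\<close> is represented by the integer \<open>a < c ^ k\<close> whose base \<open>c\<close> digits are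
  the common first \<open>k\<close> digits of its points. In this form truncating a digit is \<open>a div c\<close>, and a scramble
  acts on intervals by recursion on the level.
\<close>

primrec word :: "nat \<Rightarrow> nat \<Rightarrow> nat \<Rightarrow> nat list" where
  "word c 0 a = []"
| "word c (Suc k) a = word c k (a div c) @ [a mod c]"

primrec scramble_cell :: "nat \<Rightarrow> (nat list \<Rightarrow> nat \<Rightarrow> nat) \<Rightarrow> nat \<Rightarrow> nat \<Rightarrow> nat" where
  "scramble_cell c p 0 a = 0"
| "scramble_cell c p (Suc k) a =
     scramble_cell c p k (a div c) * c + p (word c k (a div c)) (a mod c)"

definition cell :: "nat \<Rightarrow> nat \<Rightarrow> real \<Rightarrow> nat" where
  "cell c k t = nat \<lfloor>t * real c ^ k\<rfloor>"

lemma length_word [simp]: "length (word c k a) = k"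
  by (induction k arbitrary: a) auto

lemma set_word: "c > 0 \<Longrightarrow> set (word c k a) \<subseteq> {..<c}"
  by (induction k arbitrary: a) auto

lemma word_inject:
  assumes "a < c ^ k" "a' < c ^ k" "word c k a = word c k a'"
  shows "a = a'"
  using assms
proof (induction k arbitrary: a a')
  case (Suc k)
  from Suc.prems(3) have m: "a mod c = a' mod c" and w: "word c k (a div c) = word c k (a' div c)"
    by auto
  have "a div c < c ^ k" "a' div c < c ^ k"
    using Suc.prems(1,2) by (simp_all add: less_mult_imp_div_less mult.commute)
  then have "a div c = a' div c" using w Suc.IH by blast
  with m show ?case by (metis div_mult_mod_eq)
qed simp

lemma scramble_cell_less:
  assumes "c > 0" "\<And>w s. set w \<subseteq> {..<c} \<Longrightarrow> s < c \<Longrightarrow> p w s < c"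
  shows "scramble_cell c p k a < c ^ k"
proof (induction k arbitrary: a)
  case (Suc k)
  have "p (word c k (a div c)) (a mod c) < c"
    using assms set_word by simp
  moreover have "scramble_cell c p k (a div c) + 1 \<le> c ^ k"
    using Suc.IH by (simp add: Suc_le_eq)
  then have "(scramble_cell c p k (a div c) + 1) * c \<le> c ^ k * c" by (rule mult_right_mono) simp
  ultimately show ?case by (simp add: algebra_simps)
qed simp

text \<open>
  Scrambling an interval consults one permutation for each proper prefix of its digit string. The later
  independence arguments rest on this list of prefixes.
\<close>

lemma scramble_cell_cong:
  assumes "\<And>r. r < k \<Longrightarrow> p (word c r (a div c ^ (k - r))) = p' (word c r (a div c ^ (k - r)))"
  shows "scramble_cell c p k a = scramble_cell c p' k a"
  using assms
proof (induction k arbitrary: a)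
  case (Suc k)
  have "p (word c r (a div c div c ^ (k - r))) = p' (word c r (a div c div c ^ (k - r)))" if "r < k" for r
    using Suc.prems[of r] that by (simp add: Suc_diff_le div_mult2_eq)
  from Suc.IH[OF this] Suc.prems[of k] show ?case by simp
qed simp

lemma cell_less:
  assumes "0 \<le> t" "t < 1" "c > 0"
  shows "cell c k t < c ^ k"
proof -
  have "t * real c ^ k < real c ^ k" using assms by simp
  then have "\<lfloor>t * real c ^ k\<rfloor> < int (c ^ k)" by (simp add: floor_less_iff)
  then show ?thesis unfolding cell_def using assms by (simp add: nat_less_iff)
qed

lemma cell_div:
  assumes "0 \<le> t" "c > 0"
  shows "cell c (Suc k) t div c = cell c k t"
proof -
  have "\<lfloor>t * real c ^ Suc k\<rfloor> div int c = \<lfloor>t * real c ^ Suc k / real_of_int (int c)\<rfloor>"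
    by (rule floor_divide_real_eq_div[symmetric]) simp
  also have "t * real c ^ Suc k / real_of_int (int c) = t * real c ^ k" using assms by simp
  finally have "nat (\<lfloor>t * real c ^ Suc k\<rfloor> div int c) = nat \<lfloor>t * real c ^ k\<rfloor>" by simp
  then show ?thesis unfolding cell_def using assms by (simp add: nat_div_distrib)
qed

lemma cell_div_power:
  assumes "0 \<le> t" "c > 0" "l \<le> k"
  shows "cell c k t div c ^ (k - l) = cell c l t"
proof -
  have "cell c (l + r) t div c ^ r = cell c l t" for r
  proof (induction r)
    case (Suc r)
    have "cell c (l + Suc r) t div c ^ Suc r = cell c (Suc (l + r)) t div c div c ^ r"
      by (simp add: div_mult2_eq)
    with Suc show ?case using cell_div[OF assms(1,2)] by simp
  qed simp
  from this[of "k - l"] assms(3) show ?thesis by simp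
qed

lemma digit_eq_cell_mod:
  assumes "0 \<le> t" "c > 0"
  shows "digit c k t = cell c k t mod c"
  unfolding digit_def cell_def using assms by (simp add: nat_mod_distrib)

lemma map_digit_eq_word:
  assumes "0 \<le> t" "c > 0"
  shows "map (\<lambda>i. digit c i t) [1..<Suc k] = word c k (cell c k t)"
proof (induction k)
  case (Suc k)
  then show ?case using cell_div[OF assms] digit_eq_cell_mod[OF assms] by simp
qed simp

text \<open>
  A nested scramble respects the nesting of intervals: the first \<open>l\<close> scrambled digits are determined by
  the first \<open>l\<close> digits.
\<close>

lemma scramble_cell_div:
  assumes "c > 0" "\<And>w s. set w \<subseteq> {..<c} \<Longrightarrow> s < c \<Longrightarrow> p w s < c" "l \<le> k"
  shows "scramble_cell c p k a div c ^ (k - l) = scramble_cell c p l (a div c ^ (k - l))"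
proof -
  have "scramble_cell c p (l + r) a div c ^ r = scramble_cell c p l (a div c ^ r)" for r
  proof (induction r arbitrary: a)
    case (Suc r)
    have "p (word c (l + r) (a div c)) (a mod c) < c"
      using assms set_word by simp
    then have "scramble_cell c p (l + Suc r) a div c = scramble_cell c p (l + r) (a div c)"
      by simp
    then have "scramble_cell c p (l + Suc r) a div c ^ Suc r = scramble_cell c p (l + r) (a div c) div c ^ r"
      by (simp add: div_mult2_eq)
    with Suc show ?case by (simp add: div_mult2_eq)
  qed simp
  from this[of "k - l"] assms(3) show ?thesis by simp
qed

text \<open>
  The digits after the first \<open>k\<close> contribute a number between \<open>0\<close> and \<open>c\<^sup>-\<^sup>k\<close>. The upper end is attained if
  all of them are \<open>c - 1\<close>, whence the second inequality is not strict.
\<close>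

lemma nested_map_bounds:
  assumes c: "c > 1" and p: "\<And>w s. set w \<subseteq> {..<c} \<Longrightarrow> s < c \<Longrightarrow> p w s < c" and t: "0 \<le> t"
  shows "real (scramble_cell c p k (cell c k t)) / real c ^ k \<le> nested_map c p t"
    and "nested_map c p t \<le> (real (scramble_cell c p k (cell c k t)) + 1) / real c ^ k"
proof -
  define g where "g k = real (p (word c k (cell c k t)) (digit c (Suc k) t)) / real c ^ Suc k" for k
  have nm: "nested_map c p t = suminf g"
    unfolding nested_map_def g_def using map_digit_eq_word[OF t] c by simp
  have dig: "digit c k t < c" for k using digit_eq_cell_mod[OF t] c by simp
  have g0: "0 \<le> g k" for k unfolding g_def by simp
  have plt: "p (word c k (cell c k t)) (digit c (Suc k) t) < c" for k
    using p[OF set_word dig] c by simp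
  have gle: "g k \<le> (real c - 1) / real c ^ Suc k" for k
    unfolding g_def using plt[of k] by (intro divide_right_mono) auto
  have geo: "(\<lambda>i. (real c - 1) / real c ^ Suc (i + k)) sums (1 / real c ^ k)" for k
  proof -
    have "(\<lambda>i. (real c - 1) / real c ^ Suc k * (1 / real c) ^ i) sums ((real c - 1) / real c ^ Suc k * (1 / (1 - 1 / real c)))"
      using c by (intro sums_mult geometric_sums) auto
    moreover have "(real c - 1) / real c ^ Suc k * (1 / (1 - 1 / real c)) = 1 / real c ^ k"
      using c by (simp add: field_simps)
    moreover have "(\<lambda>i. (real c - 1) / real c ^ Suc k * (1 / real c) ^ i) = (\<lambda>i. (real c - 1) / real c ^ Suc (i + k))"
      by (auto simp: fun_eq_iff power_add power_one_over field_simps)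
    ultimately show ?thesis by simp
  qed
  have sg: "summable g"
    by (rule summable_comparison_test'[of "\<lambda>k. (real c - 1) / real c ^ Suc k" 0])
      (use geo[of 0] gle g0 in \<open>auto simp: sums_iff\<close>)
  have part: "(\<Sum>i<k. g i) = real (scramble_cell c p k (cell c k t)) / real c ^ k" for k
  proof (induction k)
    case (Suc k)
    have "(\<Sum>i<Suc k. g i) = real (scramble_cell c p k (cell c k t)) / real c ^ k + g k"
      using Suc by simp
    also have "\<dots> = (real (scramble_cell c p k (cell c k t)) * real c
        + real (p (word c k (cell c k t)) (digit c (Suc k) t))) / real c ^ Suc k"
      unfolding g_def using c by (simp add: add_divide_distrib)
    also have "\<dots> = real (scramble_cell c p (Suc k) (cell c (Suc k) t)) / real c ^ Suc k"
      using cell_div[OF t] digit_eq_cell_mod[OF t] c by simp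
    finally show ?case .
  qed simp
  have split: "suminf g = (\<Sum>i. g (i + k)) + (\<Sum>i<k. g i)"
    by (rule suminf_split_initial_segment[OF sg])
  have sgk: "summable (\<lambda>i. g (i + k))" by (simp only: summable_iff_shift sg)
  have "0 \<le> (\<Sum>i. g (i + k))" by (rule suminf_nonneg[OF sgk g0])
  with split part show "real (scramble_cell c p k (cell c k t)) / real c ^ k \<le> nested_map c p t"
    by (simp add: nm)
  have "(\<Sum>i. g (i + k)) \<le> (\<Sum>i. (real c - 1) / real c ^ Suc (i + k))"
    using geo[of k] sgk gle by (intro suminf_le) (auto simp: sums_iff)
  also have "\<dots> = 1 / real c ^ k" using geo[of k] by (simp add: sums_iff)
  finally show "nested_map c p t \<le> (real (scramble_cell c p k (cell c k t)) + 1) / real c ^ k"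
    using split part by (simp add: nm add_divide_distrib)
qed

section \<open>Haar kernels on a fine grid\<close>

text \<open>
  As a kernel on \<open>{0..<c ^ K}\<close>, \<open>block_average c K k a\<close> averages over the grid points in the interval \<open>a\<close> of
  level \<open>k\<close>; \<open>haar\<close> is the increment of these averages from level \<open>k - 1\<close> to level \<open>k\<close>.
\<close>

definition block_average :: "nat \<Rightarrow> nat \<Rightarrow> nat \<Rightarrow> nat \<Rightarrow> nat \<Rightarrow> real" where
  "block_average c K k a y = (if y div c ^ (K - k) = a then 1 / real c ^ (K - k) else 0)"

lemma block_average_nonneg: "0 \<le> block_average c K k a y"
  by (simp add: block_average_def)

primrec haar :: "nat \<Rightarrow> nat \<Rightarrow> nat \<Rightarrow> nat \<Rightarrow> nat \<Rightarrow> real" where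
  "haar c K 0 a y = block_average c K 0 a y"
| "haar c K (Suc k) a y = block_average c K (Suc k) a y - block_average c K k (a div c) y"

text \<open>
  The increments telescope; at \<open>k = K\<close> the block is a single grid point and the average is evaluation.
\<close>

lemma sum_haar_levels:
  assumes "c > 0" "k \<le> K"
  shows "(\<Sum>l\<le>k. haar c K l (z div c ^ (k - l)) y) = block_average c K k z y"
  using assms(2)
proof (induction k arbitrary: z)
  case (Suc k)
  have "(\<Sum>l\<le>k. haar c K l (z div c ^ (Suc k - l)) y) = (\<Sum>l\<le>k. haar c K l (z div c div c ^ (k - l)) y)"
    by (intro sum.cong refl) (simp add: Suc_diff_le div_mult2_eq)
  also have "\<dots> = block_average c K k (z div c) y" using Suc by simp
  finally show ?case by simp
qed simp

lemma sum_block_average_digit: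
  assumes "c > 0" "Suc k \<le> K"
  shows "(\<Sum>s<c. block_average c K (Suc k) (q * c + s) y) = real c * block_average c K k q y"
proof -
  define Y where "Y = y div c ^ (K - Suc k)"
  have "K - k = Suc (K - Suc k)" using assms by simp
  then have e: "c ^ (K - k) = c ^ (K - Suc k) * c" by simp
  then have Y: "y div c ^ (K - k) = Y div c" by (simp add: Y_def div_mult2_eq)
  have "block_average c K (Suc k) (q * c + s) y
      = (if s = Y mod c \<and> Y div c = q then 1 / real c ^ (K - Suc k) else 0)" if "s < c" for s
  proof -
    have "Y = q * c + s \<longleftrightarrow> s = Y mod c \<and> Y div c = q" using that assms(1) by auto
    then show ?thesis by (simp add: block_average_def Y_def)
  qed
  then have "(\<Sum>s<c. block_average c K (Suc k) (q * c + s) y)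
     = (\<Sum>s<c. if s = Y mod c then (if Y div c = q then 1 / real c ^ (K - Suc k) else 0) else 0)"
    by (intro sum.cong) auto
  also have "\<dots> = (if Y div c = q then 1 / real c ^ (K - Suc k) else 0)"
    using assms(1) by simp
  also have "\<dots> = real c * block_average c K k q y"
  proof -
    have "real c ^ (K - k) = real c ^ (K - Suc k) * real c" using e by (metis of_nat_mult of_nat_power)
    then show ?thesis unfolding block_average_def Y using assms(1) by simp
  qed
  finally show ?thesis .
qed

text \<open>
  The mean of the averages over the children of an interval is the average over the interval, so
  the increments cancel over the last digit.
\<close>

lemma sum_haar_digit:
  assumes "c > 0" "Suc k \<le> K"
  shows "(\<Sum>s<c. haar c K (Suc k) (q * c + s) y) = 0"
proof -
  have "(\<Sum>s<c. haar c K (Suc k) (q * c + s) y)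
      = (\<Sum>s<c. block_average c K (Suc k) (q * c + s) y) - (\<Sum>s<c. block_average c K k q y)"
    by (simp add: sum_subtractf)
  then show ?thesis using sum_block_average_digit[OF assms] by simp
qed

lemma block_eq_interval:
  assumes "N > 0"
  shows "{y. y div N = (a::nat)} = {a * N..<a * N + N}"
proof -
  have "y div N = a \<longleftrightarrow> a * N \<le> y \<and> y < a * N + N" for y
  proof
    assume "y div N = a"
    then have "y = a * N + y mod N" by (metis div_mult_mod_eq)
    moreover have "y mod N < N" using assms by simp
    ultimately show "a * N \<le> y \<and> y < a * N + N" by linarith
  next
    assume "a * N \<le> y \<and> y < a * N + N"
    then have "a * N \<le> y" "y < Suc a * N" by simp_all
    then have "a \<le> y div N" "y div N < Suc a"
      using assms by (simp_all only: less_eq_div_iff_mult_less_eq div_less_iff_less_mult)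
    then show "y div N = a" by simp
  qed
  then show ?thesis by (intro set_eqI) (simp only: mem_Collect_eq atLeastLessThan_iff)
qed

lemma sum_block_average:
  assumes "c > 0" "k \<le> K" "a < c ^ k"
  shows "(\<Sum>y<c ^ K. block_average c K k a y) = 1"
proof -
  let ?N = "c ^ (K - k)"
  have e: "c ^ K = c ^ k * ?N" using assms(2) by (simp flip: power_add)
  have "{y. y div ?N = a} \<subseteq> {..<c ^ K}"
  proof
    fix y assume "y \<in> {y. y div ?N = a}"
    then have "y div ?N < c ^ k" using assms(3) by simp
    then show "y \<in> {..<c ^ K}" unfolding e using assms(1) by (simp add: div_less_iff_less_mult)
  qed
  then have "{..<c ^ K} \<inter> {y. y div ?N = a} = {a * ?N..<a * ?N + ?N}"
    using block_eq_interval[of ?N a] assms(1) by auto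
  then have "(\<Sum>y<c ^ K. block_average c K k a y) = (\<Sum>y\<in>{a * ?N..<a * ?N + ?N}. 1 / real c ^ (K - k))"
    unfolding block_average_def by (subst sum.inter_filter[symmetric]) (auto simp: Collect_conj_eq lessThan_def)
  also have "\<dots> = 1" using assms(1) by simp
  finally show ?thesis .
qed

lemma sum_haar:
  assumes "c > 0" "Suc k \<le> K" "a < c ^ Suc k"
  shows "(\<Sum>y<c ^ K. haar c K (Suc k) a y) = 0"
proof -
  have "a div c < c ^ k" using assms(3) by (simp add: less_mult_imp_div_less mult.commute)
  then show ?thesis using sum_block_average[OF assms] sum_block_average[of c k K "a div c"] assms
    by (simp add: sum_subtractf)
qed

lemma sum_abs_haar_0:
  assumes "c > 0"
  shows "(\<Sum>y<c ^ K. \<bar>haar c K 0 0 y\<bar>) = 1"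
proof -
  have "\<bar>haar c K 0 0 y\<bar> = block_average c K 0 0 y" for y by (simp add: block_average_def)
  then show ?thesis using sum_block_average[of c 0 K 0] assms by simp
qed

text \<open>
  The kernel lives on the block of level \<open>k\<close>, of width \<open>c\<^sup>-\<^sup>k\<close> and left end \<open>q\<close>, and has total mass at most
  \<open>2\<close>. As its sum is \<open>0\<close>, applying it to a function amounts to averaging increments from \<open>q\<close>.
\<close>

lemma sum_abs_haar_distance:
  assumes "c > 0" "Suc k \<le> K" "a < c ^ Suc k"
  defines "q \<equiv> real (a div c * c ^ (K - k)) / real c ^ K"
  shows "(\<Sum>y<c ^ K. \<bar>haar c K (Suc k) a y\<bar> * \<bar>real y / real c ^ K - q\<bar>) \<le> 2 / real c ^ k"
    and "0 \<le> q" and "q < 1"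
proof -
  have e: "real c ^ K = real c ^ k * real c ^ (K - k)" using assms(2) by (simp flip: power_add)
  have ac: "a div c < c ^ k" using assms(3) by (simp add: less_mult_imp_div_less mult.commute)
  show "0 \<le> q" by (simp add: q_def)
  have "real (a div c) < real c ^ k" using ac by (metis of_nat_less_iff of_nat_power)
  then show "q < 1" unfolding q_def e using assms(1) by simp
  have eN: "K - k = Suc (K - Suc k)" using assms(2) by simp
  have "\<bar>haar c K (Suc k) a y\<bar> * \<bar>real y / real c ^ K - q\<bar>
      \<le> (block_average c K (Suc k) a y + block_average c K k (a div c) y) * (1 / real c ^ k)" for y
  proof (cases "y div c ^ (K - k) = a div c")
    case True
    then have y: "a div c * c ^ (K - k) \<le> y" "y < a div c * c ^ (K - k) + c ^ (K - k)"
      using block_eq_interval[of "c ^ (K - k)" "a div c"] assms(1) by auto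
    have "real y / real c ^ K - q = (real y - real (a div c * c ^ (K - k))) / real c ^ K"
      unfolding q_def by (rule diff_divide_distrib[symmetric])
    moreover have "real y - real (a div c * c ^ (K - k)) \<ge> 0" using y(1) by (simp only: of_nat_le_iff diff_ge_0_iff_ge)
    moreover have "real y - real (a div c * c ^ (K - k)) \<le> real c ^ (K - k)"
    proof -
      have "real y \<le> real (a div c * c ^ (K - k) + c ^ (K - k))" using y(2) by (simp only: of_nat_le_iff less_imp_le)
      then show ?thesis by simp
    qed
    ultimately have "\<bar>real y / real c ^ K - q\<bar> \<le> real c ^ (K - k) / real c ^ K"
      by (simp add: divide_right_mono)
    also have "\<dots> = 1 / real c ^ k" unfolding e using assms(1) by simp
    finally have 1: "\<bar>real y / real c ^ K - q\<bar> \<le> 1 / real c ^ k" .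
    have 2: "\<bar>haar c K (Suc k) a y\<bar> \<le> block_average c K (Suc k) a y + block_average c K k (a div c) y"
      using block_average_nonneg[of c K "Suc k" a y] block_average_nonneg[of c K k "a div c" y]
      by (simp add: abs_le_iff)
    show ?thesis by (intro mult_mono 1 2) (auto simp: block_average_def)
  next
    case False
    have "c ^ (K - k) = c ^ (K - Suc k) * c" by (simp add: eN)
    then have "y div c ^ (K - k) = y div c ^ (K - Suc k) div c" by (simp add: div_mult2_eq)
    then have "y div c ^ (K - Suc k) \<noteq> a" using False by auto
    then have "haar c K (Suc k) a y = 0" using False by (simp add: block_average_def)
    then show ?thesis by (simp add: block_average_def)
  qed
  then have "(\<Sum>y<c ^ K. \<bar>haar c K (Suc k) a y\<bar> * \<bar>real y / real c ^ K - q\<bar>)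
    \<le> (\<Sum>y<c ^ K. (block_average c K (Suc k) a y + block_average c K k (a div c) y) * (1 / real c ^ k))"
    by (intro sum_mono) blast
  also have "\<dots> = 2 / real c ^ k"
    using sum_block_average[OF assms(1-3)] sum_block_average[of c k K "a div c"] ac assms(1,2)
    by (simp only: sum_distrib_right[symmetric] sum.distrib) simp
  finally show "(\<Sum>y<c ^ K. \<bar>haar c K (Suc k) a y\<bar> * \<bar>real y / real c ^ K - q\<bar>) \<le> 2 / real c ^ k" .
qed

section \<open>Mixed differences and mixed partial derivatives\<close>

abbreviation upd :: "real ^ 'n \<Rightarrow> 'n \<Rightarrow> real \<Rightarrow> real ^ 'n" where
  "upd x j t \<equiv> (\<chi> i. if i = j then t else x $ i)"

lemma upd_in_unit_cube: "x \<in> unit_cube \<Longrightarrow> 0 \<le> t \<Longrightarrow> t < 1 \<Longrightarrow> upd x j t \<in> unit_cube"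
  by (simp add: unit_cube_def)

lemma upd_commute: "i \<noteq> j \<Longrightarrow> upd (upd x i s) j t = upd (upd x j t) i s"
  by (simp add: vec_eq_iff)

lemma has_mixed_partial_freeze:
  fixes f h :: "real ^ 'n::finite \<Rightarrow> real"
  assumes "has_mixed_partial js f h" "j \<notin> set js" "0 \<le> p" "p < 1"
  shows "has_mixed_partial js (\<lambda>x. f (upd x j p)) (\<lambda>x. h (upd x j p))"
  using assms(1,2)
proof (induction js arbitrary: h)
  case Nil
  then show ?case using upd_in_unit_cube assms(3,4) by auto
next
  case (Cons i js)
  then obtain h' where h': "has_mixed_partial js f h'"
    and d: "\<And>x. x \<in> unit_cube \<Longrightarrow> ((\<lambda>t. h' (upd x i t)) has_real_derivative h x) (at (x $ i) within {0..<1})"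
    by auto
  have "i \<noteq> j" using Cons.prems(2) by auto
  have "((\<lambda>t. h' (upd (upd x i t) j p)) has_real_derivative h (upd x j p)) (at (x $ i) within {0..<1})"
    if "x \<in> unit_cube" for x
    using d[OF upd_in_unit_cube[OF that assms(3,4), of j]] \<open>i \<noteq> j\<close>
    by (simp add: upd_commute[OF \<open>i \<noteq> j\<close>])
  then show ?case using Cons.IH[OF h'] Cons.prems(2) by (auto intro!: exI)
qed

lemma has_mixed_partial_sum:
  fixes f h :: "'i \<Rightarrow> real ^ 'n::finite \<Rightarrow> real"
  assumes "\<And>y. y \<in> Y \<Longrightarrow> has_mixed_partial js (f y) (h y)"
  shows "has_mixed_partial js (\<lambda>x. \<Sum>y\<in>Y. w y * f y x) (\<lambda>x. \<Sum>y\<in>Y. w y * h y x)"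
  using assms
proof (induction js arbitrary: h)
  case (Cons i js)
  then have "\<forall>y\<in>Y. \<exists>h'. has_mixed_partial js (f y) h' \<and> (\<forall>x\<in>unit_cube.
      ((\<lambda>t. h' (upd x i t)) has_real_derivative h y x) (at (x $ i) within {0..<1}))"
    by simp
  from bchoice[OF this] obtain h' where h': "\<And>y. y \<in> Y \<Longrightarrow> has_mixed_partial js (f y) (h' y)"
    and d: "\<And>y x. y \<in> Y \<Longrightarrow> x \<in> unit_cube \<Longrightarrow>
      ((\<lambda>t. h' y (upd x i t)) has_real_derivative h y x) (at (x $ i) within {0..<1})"
    by blast
  have "((\<lambda>t. \<Sum>y\<in>Y. w y * h' y (upd x i t)) has_real_derivative (\<Sum>y\<in>Y. w y * h y x))
      (at (x $ i) within {0..<1})" if "x \<in> unit_cube" for x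
    by (intro DERIV_sum DERIV_cmult d that)
  then show ?case using Cons.IH[OF h'] by (auto intro!: exI[of _ "\<lambda>x. \<Sum>y\<in>Y. w y * h' y x"])
qed simp

lemma has_mixed_partial_increment_bound:
  fixes h g :: "real ^ 'n::finite \<Rightarrow> real"
  assumes d: "\<And>x. x \<in> unit_cube \<Longrightarrow>
      ((\<lambda>t. h (upd x i t)) has_real_derivative g x) (at (x $ i) within {0..<1})"
    and B: "\<And>x. x \<in> unit_cube \<Longrightarrow> \<bar>g x\<bar> \<le> B"
    and x: "x \<in> unit_cube" and p: "0 \<le> p" "p < 1" and q: "0 \<le> q" "q < 1"
  shows "\<bar>h (upd x i p) - h (upd x i q)\<bar> \<le> B * \<bar>p - q\<bar>"
proof -
  have "norm (h (upd x i p) - h (upd x i q)) \<le> B * norm (p - q)"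
  proof (rule field_differentiable_bound[where S = "{0..<1::real}" and f' = "\<lambda>t. g (upd x i t)"])
    fix t :: real assume "t \<in> {0..<1}"
    then have c: "upd x i t \<in> unit_cube" using x by (simp add: upd_in_unit_cube)
    have "(\<lambda>s. h (upd (upd x i t) i s)) = (\<lambda>s. h (upd x i s))"
      by (intro ext arg_cong[of _ _ h]) (simp add: vec_eq_iff)
    then show "((\<lambda>t. h (upd x i t)) has_real_derivative g (upd x i t)) (at t within {0..<1})"
      using d[OF c] by simp
    show "norm (g (upd x i t)) \<le> B" using B[OF c] by simp
  qed (use p q in auto)
  then show ?thesis by simp
qed

text \<open>
  A product of one-dimensional kernels is applied to \<open>f\<close>. In each direction of \<open>u\<close> the kernel annihilates
  constants, so it turns into increments, which the mean value theorem trades for a partial derivative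
  and a factor \<open>C j\<close>; in the other directions it is bounded by its total mass. Directions are treated in the
  order of the list, so that each time the outermost derivative is the one to be traded: applying the kernel in
  one variable commutes with the derivatives in the others.
\<close>

lemma mixed_difference_bound:
  fixes f h :: "real ^ 'n::finite \<Rightarrow> real" and w :: "'n \<Rightarrow> 'y \<Rightarrow> real"
  assumes "has_mixed_partial (filter (\<lambda>j. j \<in> u) js) f h" "\<And>x. x \<in> unit_cube \<Longrightarrow> \<bar>h x\<bar> \<le> B"
    and "distinct js" and "0 \<le> B"
    and fin: "\<And>j. finite (Y j)"
    and p: "\<And>j y. y \<in> Y j \<Longrightarrow> 0 \<le> p j y \<and> p j y < 1"
    and q: "\<And>j. j \<in> u \<Longrightarrow> 0 \<le> q j \<and> q j < 1"
    and z: "\<And>j. j \<in> u \<Longrightarrow> (\<Sum>y\<in>Y j. w j y) = 0"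
    and C1: "\<And>j. j \<in> u \<Longrightarrow> (\<Sum>y\<in>Y j. \<bar>w j y\<bar> * \<bar>p j y - q j\<bar>) \<le> C j"
    and C0: "\<And>j. j \<notin> u \<Longrightarrow> (\<Sum>y\<in>Y j. \<bar>w j y\<bar>) \<le> C j"
    and x: "x \<in> unit_cube"
  shows "\<bar>\<Sum>y\<in>PiE (set js) Y. (\<Prod>j\<in>set js. w j (y j)) * f (\<chi> i. if i \<in> set js then p i (y i) else x $ i)\<bar>
         \<le> B * (\<Prod>j\<in>set js. C j)"
  using assms(1-4)
proof (induction js arbitrary: f h B)
  case Nil
  then show ?case using x by simp
next
  case (Cons j js)
  let ?S = "set js"
  have j: "j \<notin> ?S" and dist: "distinct js" using Cons.prems(3) by auto
  have C: "0 \<le> C j"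
  proof (cases "j \<in> u")
    case True
    have "0 \<le> (\<Sum>y\<in>Y j. \<bar>w j y\<bar> * \<bar>p j y - q j\<bar>)" by (intro sum_nonneg) auto
    then show ?thesis using C1[OF True] by linarith
  next
    case False
    have "0 \<le> (\<Sum>y\<in>Y j. \<bar>w j y\<bar>)" by (intro sum_nonneg) auto
    then show ?thesis using C0[OF False] by linarith
  qed
  \<comment> \<open>the kernel in direction \<open>j\<close>, acting on functions on the cube\<close>
  define T where "T g = (\<lambda>x. \<Sum>t\<in>Y j. w j t * g (upd x j (p j t)))" for g :: "real ^ 'n \<Rightarrow> real"
  have T: "has_mixed_partial ks (T g) (T g')"
    if "has_mixed_partial ks g g'" "j \<notin> set ks" for g g' ks
    unfolding T_def using p by (intro has_mixed_partial_sum has_mixed_partial_freeze that) auto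
  have "\<exists>h'. has_mixed_partial (filter (\<lambda>j. j \<in> u) js) (T f) h' \<and> (\<forall>x\<in>unit_cube. \<bar>h' x\<bar> \<le> B * C j)"
  proof (cases "j \<in> u")
    case True
    with Cons.prems(1) obtain h' where h': "has_mixed_partial (filter (\<lambda>j. j \<in> u) js) f h'"
      and d: "\<And>x. x \<in> unit_cube \<Longrightarrow> ((\<lambda>t. h' (upd x j t)) has_real_derivative h x) (at (x $ j) within {0..<1})"
      by auto
    have "\<bar>T h' x\<bar> \<le> B * C j" if x: "x \<in> unit_cube" for x
    proof -
      have "T h' x = (\<Sum>t\<in>Y j. w j t * h' (upd x j (p j t))) - (\<Sum>t\<in>Y j. w j t) * h' (upd x j (q j))"
        unfolding T_def using z[OF True] by simp
      also have "\<dots> = (\<Sum>t\<in>Y j. w j t * (h' (upd x j (p j t)) - h' (upd x j (q j))))"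
        by (simp add: sum_distrib_right sum_subtractf right_diff_distrib)
      also have "\<bar>\<dots>\<bar> \<le> (\<Sum>t\<in>Y j. \<bar>w j t\<bar> * (B * \<bar>p j t - q j\<bar>))"
      proof (rule order_trans[OF sum_abs], rule sum_mono)
        fix t assume "t \<in> Y j"
        then have "\<bar>h' (upd x j (p j t)) - h' (upd x j (q j))\<bar> \<le> B * \<bar>p j t - q j\<bar>"
          using has_mixed_partial_increment_bound[OF d Cons.prems(2) x] p q[OF True] by blast
        then show "\<bar>w j t * (h' (upd x j (p j t)) - h' (upd x j (q j)))\<bar> \<le> \<bar>w j t\<bar> * (B * \<bar>p j t - q j\<bar>)"
          by (simp add: abs_mult mult_left_mono)
      qed
      also have "\<dots> = B * (\<Sum>t\<in>Y j. \<bar>w j t\<bar> * \<bar>p j t - q j\<bar>)"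
        by (simp add: sum_distrib_left mult_ac)
      also have "\<dots> \<le> B * C j" using C1[OF True] Cons.prems(4) by (rule mult_left_mono)
      finally show ?thesis .
    qed
    then show ?thesis using T[OF h'] j by auto
  next
    case False
    have "\<bar>T h x\<bar> \<le> B * C j" if x: "x \<in> unit_cube" for x
    proof -
      have "\<bar>T h x\<bar> \<le> (\<Sum>t\<in>Y j. \<bar>w j t\<bar> * B)"
        unfolding T_def
      proof (rule order_trans[OF sum_abs], rule sum_mono)
        fix t assume "t \<in> Y j"
        then show "\<bar>w j t * h (upd x j (p j t))\<bar> \<le> \<bar>w j t\<bar> * B"
          using Cons.prems(2)[OF upd_in_unit_cube[OF x]] p by (simp add: abs_mult mult_left_mono)
      qed
      also have "\<dots> = B * (\<Sum>t\<in>Y j. \<bar>w j t\<bar>)" by (simp add: sum_distrib_left mult_ac)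
      also have "\<dots> \<le> B * C j" using C0[OF False] Cons.prems(4) by (rule mult_left_mono)
      finally show ?thesis .
    qed
    moreover have "has_mixed_partial (filter (\<lambda>j. j \<in> u) js) f h" using Cons.prems(1) False by simp
    ultimately show ?thesis using T j by (intro exI[of _ "T h"]) auto
  qed
  then obtain h' where h': "has_mixed_partial (filter (\<lambda>j. j \<in> u) js) (T f) h'"
    and B': "\<And>x. x \<in> unit_cube \<Longrightarrow> \<bar>h' x\<bar> \<le> B * C j" by blast
  \<comment> \<open>the direction \<open>j\<close> is summed first, which turns \<open>f\<close> into \<open>T f\<close>\<close>
  have "(\<Sum>y\<in>PiE (set (j # js)) Y. (\<Prod>i\<in>set (j # js). w i (y i)) * f (\<chi> i. if i \<in> set (j # js) then p i (y i) else x $ i))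
      = (\<Sum>(t, y)\<in>Y j \<times> PiE ?S Y. (\<Prod>i\<in>?S. w i (y i)) * (w j t * f (upd (\<chi> i. if i \<in> ?S then p i (y i) else x $ i) j (p j t))))"
    (is "?L = _")
  proof -
    have "(\<Prod>i\<in>set (j # js). w i ((y(j := t)) i)) * f (\<chi> i. if i \<in> set (j # js) then p i ((y(j := t)) i) else x $ i)
      = (\<Prod>i\<in>?S. w i (y i)) * (w j t * f (upd (\<chi> i. if i \<in> ?S then p i (y i) else x $ i) j (p j t)))" for y t
    proof -
      have "(\<Prod>i\<in>?S. w i ((y(j := t)) i)) = (\<Prod>i\<in>?S. w i (y i))"
        using j by (intro prod.cong) auto
      moreover have "(\<chi> i. if i \<in> set (j # js) then p i ((y(j := t)) i) else x $ i)
          = upd (\<chi> i. if i \<in> ?S then p i (y i) else x $ i) j (p j t)"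
        by (simp add: vec_eq_iff)
      ultimately show ?thesis using j by simp
    qed
    then show ?thesis
      unfolding list.set(2) PiE_insert_eq
      by (subst sum.reindex[OF inj_combinator[OF j]]) (simp add: case_prod_unfold)
  qed
  also have "\<dots> = (\<Sum>y\<in>PiE ?S Y. (\<Prod>i\<in>?S. w i (y i)) * T f (\<chi> i. if i \<in> ?S then p i (y i) else x $ i))"
    unfolding T_def sum_distrib_left by (subst sum.cartesian_product[symmetric], subst sum.swap) simp
  finally have "\<bar>?L\<bar> \<le> B * C j * (\<Prod>j\<in>?S. C j)"
    using Cons.IH[OF h' B' dist] Cons.prems(4) C by simp
  then show ?case using j by (simp add: mult.assoc)
qed

lemma filter_sorted_list_of_UNIV:
  "filter (\<lambda>j. j \<in> u) (sorted_list_of_set UNIV) = sorted_list_of_set (u :: 'n::{finite,linorder} set)"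
  by (rule sorted_distinct_set_unique) (auto intro: sorted_wrt_filter)

section \<open>Haar components of a function\<close>

definition grid_point :: "('n \<Rightarrow> nat) \<Rightarrow> nat \<Rightarrow> ('n \<Rightarrow> nat) \<Rightarrow> real ^ 'n" where
  "grid_point c K y = (\<chi> j. real (y j) / real (c j) ^ K)"

definition component ::
    "('n::finite \<Rightarrow> nat) \<Rightarrow> nat \<Rightarrow> (real ^ 'n \<Rightarrow> real) \<Rightarrow> ('n \<Rightarrow> nat) \<Rightarrow> ('n \<Rightarrow> nat) \<Rightarrow> real" where
  "component c K f k a =
     (\<Sum>y\<in>PiE UNIV (\<lambda>j. {..<c j ^ K}).
        (\<Prod>j\<in>UNIV. haar (c j) K (k j) (a j) (y j)) * f (grid_point c K y))"

text \<open>
  The tensor product of the one-dimensional telescoping sums.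
\<close>

lemma sum_components:
  fixes c :: "'n::finite \<Rightarrow> nat"
  assumes c: "\<And>j. c j > 0" and z: "\<And>j. z j < c j ^ K"
  shows "(\<Sum>k\<in>PiE UNIV (\<lambda>_. {..K}). component c K f k (\<lambda>j. z j div c j ^ (K - k j)))
       = f (grid_point c K z)"
proof -
  let ?Y = "PiE UNIV (\<lambda>j. {..<c j ^ K})"
  have "(\<Sum>k\<in>PiE UNIV (\<lambda>_. {..K}). component c K f k (\<lambda>j. z j div c j ^ (K - k j)))
     = (\<Sum>y\<in>?Y. (\<Sum>k\<in>PiE UNIV (\<lambda>_. {..K}). \<Prod>j\<in>UNIV. haar (c j) K (k j) (z j div c j ^ (K - k j)) (y j))
          * f (grid_point c K y))"
    unfolding component_def sum_distrib_right by (rule sum.swap)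
  also have "\<dots> = (\<Sum>y\<in>?Y. (if y = z then f (grid_point c K y) else 0))"
  proof (intro sum.cong refl)
    fix y assume "y \<in> ?Y"
    have "(\<Sum>k\<in>PiE UNIV (\<lambda>_. {..K}). \<Prod>j\<in>UNIV. haar (c j) K (k j) (z j div c j ^ (K - k j)) (y j))
        = (\<Prod>j\<in>UNIV. \<Sum>l\<le>K. haar (c j) K l (z j div c j ^ (K - l)) (y j))"
      by (rule prod_sum_PiE[symmetric]) auto
    also have "\<dots> = (\<Prod>j\<in>UNIV. if y j = z j then 1 else 0)"
    proof (rule prod.cong[OF refl])
      fix j
      show "(\<Sum>l\<le>K. haar (c j) K l (z j div c j ^ (K - l)) (y j)) = (if y j = z j then 1 else 0)"
        using sum_haar_levels[OF c order_refl, of j K "z j" "y j"] by (simp add: block_average_def)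
    qed
    also have "\<dots> = (if y = z then 1 else 0)"
      by (auto simp: fun_eq_iff)
    finally show "(\<Sum>k\<in>PiE UNIV (\<lambda>_. {..K}). \<Prod>j\<in>UNIV. haar (c j) K (k j) (z j div c j ^ (K - k j)) (y j))
        * f (grid_point c K y) = (if y = z then f (grid_point c K y) else 0)" by simp
  qed
  also have "\<dots> = f (grid_point c K z)"
    using z by (subst sum.delta) (auto intro!: finite_PiE)
  finally show ?thesis .
qed

lemma sum_component_digit:
  assumes "c j > 0" "k j = Suc q" "k j \<le> K"
  shows "(\<Sum>s<c j. component c K f k (a(j := r * c j + s))) = 0"
proof -
  have "(\<Prod>i\<in>UNIV. haar (c i) K (k i) ((a(j := t)) i) (y i))
      = haar (c j) K (k j) t (y j) * (\<Prod>i\<in>UNIV - {j}. haar (c i) K (k i) (a i) (y i))" for t y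
    by (subst prod.remove[of UNIV j]) auto
  then have "(\<Sum>s<c j. component c K f k (a(j := r * c j + s)))
    = (\<Sum>y\<in>PiE UNIV (\<lambda>j. {..<c j ^ K}). (\<Sum>s<c j. haar (c j) K (k j) (r * c j + s) (y j))
         * ((\<Prod>i\<in>UNIV - {j}. haar (c i) K (k i) (a i) (y i)) * f (grid_point c K y)))"
    unfolding component_def sum_distrib_right by (subst sum.swap) (simp only: mult.assoc)
  also have "\<dots> = 0" using sum_haar_digit[of "c j" q K r] assms by simp
  finally show ?thesis .
qed

definition mixed_partials_bounded_by :: "real \<Rightarrow> (real ^ 'n::{finite,linorder} \<Rightarrow> real) \<Rightarrow> bool" where
  "mixed_partials_bounded_by B f \<longleftrightarrow>
     (\<forall>u. u \<noteq> {} \<longrightarrow> (\<exists>h. has_mixed_partial (sorted_list_of_set u) f h \<and> (\<forall>x\<in>unit_cube. \<bar>h x\<bar> \<le> B)))"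

text \<open>
  The directions with \<open>k\<^sub>j > 0\<close> are those in which the kernel sums to zero. In such a direction with
  \<open>k\<^sub>j = l + 1\<close> the increments have total size \<open>2 / c\<^sub>j\<^sup>l\<close>, the factor in the statement.
  A direction with \<open>k\<^sub>j = 0\<close> contributes \<open>1\<close>, which the factor \<open>2 c\<^sub>j\<close> only enlarges.
\<close>

lemma component_bound:
  fixes c :: "'n::{finite,linorder} \<Rightarrow> nat"
  assumes f: "mixed_partials_bounded_by B f" and B: "0 \<le> B" and c: "\<And>j. c j > 0"
    and k: "\<And>j. k j \<le> K" "k \<noteq> (\<lambda>_. 0)" and a: "\<And>j. a j < c j ^ k j"
  shows "\<bar>component c K f k a\<bar> \<le> B * (\<Prod>j\<in>UNIV. 2 * real (c j) / real (c j) ^ k j)"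
proof -
  define u where "u = {j. k j \<noteq> 0}"
  have "u \<noteq> {}" using k(2) by (auto simp: u_def fun_eq_iff)
  then have "\<exists>h. has_mixed_partial (sorted_list_of_set u) f h \<and> (\<forall>x\<in>unit_cube. \<bar>h x\<bar> \<le> B)"
    using f unfolding mixed_partials_bounded_by_def by (elim allE[of _ u] impE)
  then obtain h where h: "has_mixed_partial (sorted_list_of_set u) f h"
    and hB: "\<forall>x\<in>unit_cube. \<bar>h x\<bar> \<le> B"
    by (elim exE conjE)
  define w where "w = (\<lambda>j y. haar (c j) K (k j) (a j) y)"
  define q where "q = (\<lambda>j. real (a j div c j * c j ^ (K - (k j - 1))) / real (c j) ^ K)"
  let ?L = "sorted_list_of_set (UNIV :: 'n set)"
  have 1: "\<exists>l. k j = Suc l" if "j \<in> u" for j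
    using that by (auto simp: u_def not0_implies_Suc)
  have "\<bar>\<Sum>y\<in>PiE (set ?L) (\<lambda>j. {..<c j ^ K}). (\<Prod>j\<in>set ?L. w j (y j)) *
          f (\<chi> i. if i \<in> set ?L then real (y i) / real (c i) ^ K else (0 :: real ^ 'n::{finite,linorder}) $ i)\<bar>
     \<le> B * (\<Prod>j\<in>set ?L. 2 * real (c j) / real (c j) ^ k j)"
  proof (rule mixed_difference_bound[where u = u and h = h and q = q and p = "\<lambda>i y. real y / real (c i) ^ K"])
    show "has_mixed_partial (filter (\<lambda>j. j \<in> u) ?L) f h"
      using h by (simp add: filter_sorted_list_of_UNIV)
    show "0 \<le> real y / real (c j) ^ K \<and> real y / real (c j) ^ K < 1" if "y \<in> {..<c j ^ K}" for j y
    proof -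
      have "real y < real (c j) ^ K" using that by (metis lessThan_iff of_nat_less_iff of_nat_power)
      then show ?thesis using c[of j] by simp
    qed
    fix j
    show "0 \<le> q j \<and> q j < 1" if "j \<in> u"
    proof -
      from 1[OF that] obtain l where l: "k j = Suc l" ..
      show ?thesis using sum_abs_haar_distance(2,3)[of "c j" l K "a j"] c k(1)[of j] a[of j] l
        by (simp add: q_def)
    qed
    show "(\<Sum>y<c j ^ K. w j y) = 0" if "j \<in> u"
    proof -
      from 1[OF that] obtain l where l: "k j = Suc l" ..
      show ?thesis using sum_haar[of "c j" l K "a j"] c k(1)[of j] a[of j] l
        by (simp add: w_def)
    qed
    show "(\<Sum>y<c j ^ K. \<bar>w j y\<bar> * \<bar>real y / real (c j) ^ K - q j\<bar>) \<le> 2 * real (c j) / real (c j) ^ k j"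
      if "j \<in> u"
    proof -
      from 1[OF that] obtain l where l: "k j = Suc l" ..
      have "(\<Sum>y<c j ^ K. \<bar>w j y\<bar> * \<bar>real y / real (c j) ^ K - q j\<bar>) \<le> 2 / real (c j) ^ l"
        unfolding w_def q_def l using sum_abs_haar_distance(1)[of "c j" l K "a j"] c k(1)[of j] a[of j] l
        by simp
      then show ?thesis using c[of j] l by simp
    qed
    show "(\<Sum>y<c j ^ K. \<bar>w j y\<bar>) \<le> 2 * real (c j) / real (c j) ^ k j" if "j \<notin> u"
    proof -
      have "k j = 0" using that by (simp add: u_def)
      then have "a j = 0" using a[of j] by simp
      have "1 \<le> c j" using c[of j] by simp
      then have "1 \<le> real (c j)" by simp
      then show ?thesis unfolding w_def \<open>k j = 0\<close> \<open>a j = 0\<close> sum_abs_haar_0[OF c] by simp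
    qed
    show "(0 :: real ^ 'n::{finite,linorder}) \<in> unit_cube" by (simp add: unit_cube_def)
  qed (use hB B in auto)
  then show ?thesis by (simp add: component_def w_def grid_point_def)
qed

section \<open>Equidistribution of the points\<close>

definition cells :: "('n::finite \<Rightarrow> nat) \<Rightarrow> ('n \<Rightarrow> nat) \<Rightarrow> real ^ 'n \<Rightarrow> 'n \<Rightarrow> nat" where
  "cells c k x = (\<lambda>j. cell (c j) (k j) (x $ j))"

lemma cells_eq_iff_elementary_interval:
  assumes "x \<in> unit_cube" "\<And>j. c j > 0"
  shows "x \<in> elementary_interval c k a \<longleftrightarrow> cells c k x = a"
proof -
  have "real (a j) / real (c j) ^ k j \<le> x $ j \<and> x $ j < (real (a j) + 1) / real (c j) ^ k j
      \<longleftrightarrow> cell (c j) (k j) (x $ j) = a j" for j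
  proof -
    have c: "real (c j) ^ k j > 0" using assms(2) by simp
    have x: "0 \<le> x $ j * real (c j) ^ k j" using assms(1) c by (simp add: unit_cube_def)
    have "real (a j) / real (c j) ^ k j \<le> x $ j \<and> x $ j < (real (a j) + 1) / real (c j) ^ k j
      \<longleftrightarrow> real (a j) \<le> x $ j * real (c j) ^ k j \<and> x $ j * real (c j) ^ k j < real (a j) + 1"
      by (simp only: pos_divide_le_eq[OF c] pos_less_divide_eq[OF c])
    also have "\<dots> \<longleftrightarrow> \<lfloor>x $ j * real (c j) ^ k j\<rfloor> = int (a j)"
      by (simp add: floor_eq_iff)
    also have "\<dots> \<longleftrightarrow> cell (c j) (k j) (x $ j) = a j"
    proof -
      have "0 \<le> \<lfloor>x $ j * real (c j) ^ k j\<rfloor>" using x by simp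
      then show ?thesis unfolding cell_def by linarith
    qed
    finally show ?thesis .
  qed
  then show ?thesis by (auto simp: elementary_interval_def cells_def)
qed

text \<open>
  With \<open>s = \<Sum>\<^sub>j e\<^sub>j k\<^sub>j\<close>, each of the \<open>b ^ (m - s)\<close> consecutive segments of \<open>b ^ s\<close> points meets every
  elementary interval of level \<open>k\<close> exactly once.
\<close>

lemma sum_over_net:
  fixes x :: "nat \<Rightarrow> real ^ 'n::finite" and h :: "('n \<Rightarrow> nat) \<Rightarrow> real"
  assumes net: "zero_e_sequence b e x" and b: "b > 0" and le: "(\<Sum>j\<in>UNIV. e j * k j) \<le> m"
  shows "(\<Sum>i<b ^ m. h (cells (\<lambda>j. b ^ e j) k (x i)))
       = real (b ^ (m - (\<Sum>j\<in>UNIV. e j * k j))) * (\<Sum>a\<in>PiE UNIV (\<lambda>j. {..<(b ^ e j) ^ k j}). h a)"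
proof -
  define s where "s = (\<Sum>j\<in>UNIV. e j * k j)"
  define X where "X i = cells (\<lambda>j. b ^ e j) k (x i)" for i
  let ?A = "PiE UNIV (\<lambda>j. {..<(b ^ e j) ^ k j})"
  have xc: "x i \<in> unit_cube" for i using net by (simp add: zero_e_sequence_def)
  have ex1: "\<exists>!i. i \<in> {r * b ^ s..<(r + 1) * b ^ s} \<and> X i = a" if "a \<in> ?A" for r a
  proof -
    have a: "\<forall>j. a j < (b ^ e j) ^ k j" using that by (auto simp: PiE_iff)
    have "\<exists>!i. i \<in> {r * b ^ s..<(r + 1) * b ^ s} \<and> x i \<in> elementary_interval (\<lambda>j. b ^ e j) k a"
      using net a s_def unfolding zero_e_sequence_def by simp
    then show ?thesis unfolding X_def using cells_eq_iff_elementary_interval[OF xc] b by simp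
  qed
  have XA: "X i \<in> ?A" for i
  proof -
    have "cell (b ^ e j) (k j) (x i $ j) < (b ^ e j) ^ k j" for j
      using xc[of i] b by (intro cell_less) (auto simp: unit_cube_def)
    then show ?thesis by (auto simp: X_def cells_def PiE_iff)
  qed
  have bij: "bij_betw X {r * b ^ s..<(r + 1) * b ^ s} ?A" for r
    unfolding bij_betw_def inj_on_def
  proof (intro conjI ballI impI)
    fix i i' assume "i \<in> {r * b ^ s..<(r + 1) * b ^ s}" "i' \<in> {r * b ^ s..<(r + 1) * b ^ s}" "X i = X i'"
    then show "i = i'" using ex1[OF XA[of i], of r] by auto
  next
    show "X ` {r * b ^ s..<(r + 1) * b ^ s} = ?A"
    proof
      show "?A \<subseteq> X ` {r * b ^ s..<(r + 1) * b ^ s}"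
      proof
        fix a assume "a \<in> ?A"
        with ex1[of a r] obtain i where "i \<in> {r * b ^ s..<(r + 1) * b ^ s}" "X i = a" by blast
        then show "a \<in> X ` {r * b ^ s..<(r + 1) * b ^ s}" by blast
      qed
    qed (use XA in auto)
  qed
  have "b ^ m = b ^ (m - s) * b ^ s" using le by (simp add: s_def flip: power_add)
  then have "(\<Sum>i<b ^ m. h (X i)) = (\<Sum>r<b ^ (m - s). \<Sum>i\<in>{r * b ^ s..<r * b ^ s + b ^ s}. h (X i))"
    by (simp add: sum.nat_group)
  also have "\<dots> = (\<Sum>r<b ^ (m - s). \<Sum>a\<in>?A. h a)"
    using sum.reindex_bij_betw[OF bij, of h] by (intro sum.cong refl) (simp add: algebra_simps)
  also have "\<dots> = real (b ^ (m - s)) * (\<Sum>a\<in>?A. h a)" by simp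
  finally show ?thesis by (simp add: X_def s_def)
qed

definition scrambled_cells ::
    "('n \<Rightarrow> nat) \<Rightarrow> ('n \<Rightarrow> nat list \<Rightarrow> nat \<Rightarrow> nat) \<Rightarrow> ('n \<Rightarrow> nat) \<Rightarrow> ('n \<Rightarrow> nat) \<Rightarrow> 'n \<Rightarrow> nat" where
  "scrambled_cells c p k a = (\<lambda>j. scramble_cell (c j) (p j) (k j) (a j))"

text \<open>
  In a direction with \<open>k\<^sub>j > 0\<close>, group the intervals by everything except the last digit of the \<open>j\<close>th
  coordinate. Within a group a single permutation acts on that digit, so the values of the component are only
  rearranged, and they add up to zero.
\<close>

lemma sum_scrambled_component:
  fixes c :: "'n::finite \<Rightarrow> nat"
  assumes c: "\<And>j. c j > 0" and p: "\<And>j w. set w \<subseteq> {..<c j} \<Longrightarrow> p j w permutes {..<c j}"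
    and k: "k \<noteq> (\<lambda>_. 0)" "\<And>j. k j \<le> K"
  shows "(\<Sum>a\<in>PiE UNIV (\<lambda>j. {..<c j ^ k j}). component c K f k (scrambled_cells c p k a)) = 0"
proof -
  from k(1) obtain j q where q: "k j = Suc q" by (auto simp: fun_eq_iff gr0_conv_Suc)
  let ?B = "\<lambda>j. {..<c j ^ k j}"
  let ?H = "\<lambda>a. component c K f k (scrambled_cells c p k a)"
  have U: "(UNIV :: 'n set) = insert j (UNIV - {j})" by auto
  have "(\<Sum>a\<in>PiE UNIV ?B. ?H a) = (\<Sum>(t, g)\<in>?B j \<times> PiE (UNIV - {j}) ?B. ?H (g(j := t)))"
    by (subst U, unfold PiE_insert_eq, subst sum.reindex[OF inj_combinator])
       (simp_all add: case_prod_unfold)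
  also have "\<dots> = (\<Sum>g\<in>PiE (UNIV - {j}) ?B. \<Sum>t\<in>?B j. ?H (g(j := t)))"
    by (subst sum.cartesian_product[symmetric], rule sum.swap)
  also have "\<dots> = 0"
  proof (rule sum.neutral, rule ballI)
    fix g assume "g \<in> PiE (UNIV - {j}) ?B"
    have "(\<Sum>t\<in>?B j. ?H (g(j := t))) = (\<Sum>r<c j ^ q. \<Sum>t\<in>{r * c j..<r * c j + c j}. ?H (g(j := t)))"
      using q by (simp add: sum.nat_group mult.commute)
    also have "\<dots> = (\<Sum>r<c j ^ q. \<Sum>s<c j. ?H (g(j := r * c j + s)))"
    proof (rule sum.cong[OF refl])
      fix r
      show "(\<Sum>t\<in>{r * c j..<r * c j + c j}. ?H (g(j := t))) = (\<Sum>s<c j. ?H (g(j := r * c j + s)))"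
        using sum.shift_bounds_nat_ivl[of "\<lambda>t. ?H (g(j := t))" 0 "r * c j" "c j"]
        by (simp add: atLeast0LessThan add.commute)
    qed
    also have "\<dots> = 0"
    proof (rule sum.neutral, rule ballI)
      fix r
      let ?w = "word (c j) q r"
      define A where "A = scrambled_cells c p k g"
      let ?R = "scramble_cell (c j) (p j) q r"
      have "?H (g(j := r * c j + s)) = component c K f k (A(j := ?R * c j + p j ?w s))" if "s < c j" for s
      proof -
        have "scrambled_cells c p k (g(j := r * c j + s)) = A(j := ?R * c j + p j ?w s)"
          using that q c[of j] by (auto simp: scrambled_cells_def A_def fun_eq_iff)
        then show ?thesis by simp
      qed
      then have "(\<Sum>s<c j. ?H (g(j := r * c j + s))) = (\<Sum>s<c j. component c K f k (A(j := ?R * c j + p j ?w s)))"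
        by (intro sum.cong) auto
      also have "\<dots> = (\<Sum>s<c j. component c K f k (A(j := ?R * c j + s)))"
        using sum.permute[OF p[of ?w j], of "\<lambda>s. component c K f k (A(j := ?R * c j + s))"] set_word c
        by (simp add: o_def)
      also have "\<dots> = 0" using sum_component_digit[where k = k] c q k(2) by metis
      finally show "(\<Sum>s<c j. ?H (g(j := r * c j + s))) = 0" .
    qed
    finally show "(\<Sum>t\<in>?B j. ?H (g(j := t))) = 0" .
  qed
  finally show ?thesis .
qed

lemma cells_coarser:
  assumes "x \<in> unit_cube" "\<And>j. c j > 0" "\<And>j. l j \<le> k j"
  shows "cells c l x = (\<lambda>j. cells c k x j div c j ^ (k j - l j))"
  using assms by (auto simp: cells_def cell_div_power unit_cube_def)

text \<open>
  A level at which equidistribution still applies, but with at most \<open>b\<^bsup>\<Sum>e\<^esup>\<close> points in each interval: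
  raise \<open>l\<close> below \<open>k - 1\<close> one step at a time until \<open>\<Sum>\<^sub>j e\<^sub>j l\<^sub>j\<close> would exceed \<open>m\<close>, or \<open>k - 1\<close> itself is reached.
\<close>

lemma exists_coarse_level:
  fixes e k :: "'n::finite \<Rightarrow> nat"
  assumes "(\<Sum>j\<in>UNIV. e j * k j) > m"
  shows "\<exists>l. (\<forall>j. l j \<le> k j - 1) \<and> (\<Sum>j\<in>UNIV. e j * l j) \<le> m \<and> m \<le> (\<Sum>j\<in>UNIV. e j * l j) + (\<Sum>j\<in>UNIV. e j)"
proof -
  let ?s = "\<lambda>l. \<Sum>j\<in>UNIV. e j * l j"
  define P where "P l \<longleftrightarrow> (\<forall>j. l j \<le> k j - 1) \<and> ?s l \<le> m" for l
  have "P (\<lambda>_. 0)" by (simp add: P_def)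
  moreover have "\<forall>l. P l \<longrightarrow> (\<Sum>j\<in>UNIV. l j) < Suc (\<Sum>j\<in>UNIV. k j - 1)"
    by (auto simp: P_def less_Suc_eq_le intro!: sum_mono)
  ultimately obtain l where l: "P l" and max: "\<And>l'. P l' \<Longrightarrow> (\<Sum>j\<in>UNIV. l' j) \<le> (\<Sum>j\<in>UNIV. l j)"
    using ex_has_greatest_nat[of P _ "\<lambda>l. \<Sum>j\<in>UNIV. l j"] by blast
  have "m \<le> ?s l + (\<Sum>j\<in>UNIV. e j)"
  proof (cases "\<exists>j. l j < k j - 1")
    case True
    then obtain j where j: "l j < k j - 1" by blast
    have upd: "(\<Sum>i\<in>UNIV. g i * (l(j := Suc (l j))) i) = (\<Sum>i\<in>UNIV. g i * l i) + g j" for g :: "'n \<Rightarrow> nat"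
    proof -
      have "(\<Sum>i\<in>UNIV. g i * (l(j := Suc (l j))) i) = (\<Sum>i\<in>UNIV. g i * l i + (if i = j then g j else 0))"
        by (intro sum.cong) auto
      then show ?thesis by (simp add: sum.distrib)
    qed
    have "\<not> P (l(j := Suc (l j)))" using max[of "l(j := Suc (l j))"] upd[of "\<lambda>_. 1"] by auto
    moreover have "\<forall>i. (l(j := Suc (l j))) i \<le> k i - 1" using l j by (auto simp: P_def)
    ultimately have "?s (l(j := Suc (l j))) > m" by (auto simp: P_def simp del: fun_upd_apply)
    then have "?s l + e j > m" by (simp only: upd)
    moreover have "e j \<le> (\<Sum>j\<in>UNIV. e j)" by (rule member_le_sum) auto
    ultimately show ?thesis by linarith
  next
    case False
    then have "e j * k j \<le> e j * l j + e j" for j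
    proof -
      have "k j \<le> l j + 1" using False by (metis add.commute le_diff_conv not_le)
      then have "e j * k j \<le> e j * (l j + 1)" by (rule mult_le_mono2)
      then show ?thesis by simp
    qed
    then have "?s k \<le> (\<Sum>j\<in>UNIV. e j * l j + e j)" by (intro sum_mono)
    then show ?thesis using assms by (simp add: sum.distrib)
  qed
  with l show ?thesis by (auto simp: P_def)
qed

text \<open>
  Points that agree to level \<open>k - 1\<close> agree to any coarser level, and a suitable coarser level is
  equidistributed. In a direction with \<open>k\<^sub>j = 0\<close> truncated subtraction makes the condition void.
\<close>

lemma card_close_points:
  fixes x :: "nat \<Rightarrow> real ^ 'n::finite"
  assumes net: "zero_e_sequence b e x" and b: "b > 0" and gt: "(\<Sum>j\<in>UNIV. e j * k j) > m"
  defines "c \<equiv> \<lambda>j. b ^ e j"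
  shows "card {i'. i' < b ^ m \<and> cells c (\<lambda>j. k j - 1) (x i') = cells c (\<lambda>j. k j - 1) (x i)} \<le> b ^ (\<Sum>j\<in>UNIV. e j)"
proof -
  from exists_coarse_level[OF gt] obtain l where l: "\<And>j. l j \<le> k j - 1" "(\<Sum>j\<in>UNIV. e j * l j) \<le> m"
    "m \<le> (\<Sum>j\<in>UNIV. e j * l j) + (\<Sum>j\<in>UNIV. e j)" by blast
  have xc: "x i \<in> unit_cube" for i using net by (simp add: zero_e_sequence_def)
  have c: "c j > 0" for j using b by (simp add: c_def)
  let ?a = "cells c l (x i)"
  let ?A = "PiE UNIV (\<lambda>j. {..<c j ^ l j})"
  have "{i'. i' < b ^ m \<and> cells c (\<lambda>j. k j - 1) (x i') = cells c (\<lambda>j. k j - 1) (x i)}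
      \<subseteq> {i'\<in>{..<b ^ m}. cells c l (x i') = ?a}"
    using cells_coarser[OF xc c l(1)] by auto
  then have "card {i'. i' < b ^ m \<and> cells c (\<lambda>j. k j - 1) (x i') = cells c (\<lambda>j. k j - 1) (x i)}
      \<le> card {i'\<in>{..<b ^ m}. cells c l (x i') = ?a}"
    by (rule card_mono[rotated]) simp
  also have "real \<dots> = (\<Sum>i'<b ^ m. if cells c l (x i') = ?a then 1 else 0)"
    by (simp add: sum.If_cases Collect_conj_eq lessThan_def)
  also have "\<dots> = real (b ^ (m - (\<Sum>j\<in>UNIV. e j * l j))) * (\<Sum>a\<in>?A. if a = ?a then 1 else 0)"
    unfolding c_def by (rule sum_over_net[OF net b l(2)])
  also have "\<dots> \<le> real (b ^ (m - (\<Sum>j\<in>UNIV. e j * l j))) * 1"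
    by (intro mult_left_mono) (auto simp: sum.delta finite_PiE)
  also have "\<dots> \<le> real (b ^ (\<Sum>j\<in>UNIV. e j))"
    using l(3) b by (simp add: power_increasing)
  finally show ?thesis by linarith
qed

section \<open>The random permutations\<close>

locale coarse_scramble = prob_space M
  for M :: "'w measure" +
  fixes c :: "'n::finite \<Rightarrow> nat" and P :: "'n \<Rightarrow> nat list \<Rightarrow> 'w \<Rightarrow> nat \<Rightarrow> nat"
  assumes base: "\<And>j. 2 \<le> c j"
    and scramble: "nested_scramble M c P"
    and uniform: "two_fold_uniform M c P"
begin

definition index :: "('n \<times> nat list) set" where
  "index = {(j, w). set w \<subseteq> {..<c j}}"

definition perm :: "'w \<Rightarrow> 'n \<times> nat list \<Rightarrow> nat \<Rightarrow> nat" where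
  "perm \<omega> = (\<lambda>(j, w). P j w \<omega>)"

abbreviation perms :: "'n \<times> nat list \<Rightarrow> (nat \<Rightarrow> nat) set" where
  "perms i \<equiv> {\<sigma>. \<sigma> permutes {..<c (fst i)}}"

lemma base_pos: "0 < c j"
  using base[of j] by simp

lemma finite_perms: "finite (perms i)"
  by (simp add: finite_permutations)

lemma curry_perm: "curry (perm \<omega>) = (\<lambda>j w. P j w \<omega>)"
  by (simp add: perm_def curry_def fun_eq_iff)

lemma indep_perm: "indep_vars (\<lambda>i. count_space (perms i)) (\<lambda>i \<omega>. perm \<omega> i) index"
proof -
  have "(\<lambda>(j, w). count_space {\<sigma>. \<sigma> permutes {..<c j}}) = (\<lambda>i :: 'n \<times> nat list. count_space (perms i))"
    and "(\<lambda>(j, w). P j w) = (\<lambda>i \<omega>. perm \<omega> i)"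
    by (auto simp: fun_eq_iff perm_def)
  then show ?thesis using scramble unfolding nested_scramble_def index_def by simp
qed

lemma measurable_perm: "i \<in> index \<Longrightarrow> (\<lambda>\<omega>. perm \<omega> i) \<in> M \<rightarrow>\<^sub>M count_space (perms i)"
  using indep_perm unfolding indep_vars_def by blast

lemma perm_permutes: "\<omega> \<in> space M \<Longrightarrow> i \<in> index \<Longrightarrow> perm \<omega> i permutes {..<c (fst i)}"
  using measurable_space[OF measurable_perm] by auto

lemma scramble_permutes: "\<omega> \<in> space M \<Longrightarrow> set w \<subseteq> {..<c j} \<Longrightarrow> P j w \<omega> permutes {..<c j}"
  using perm_permutes[of \<omega> "(j, w)"] by (simp add: perm_def index_def)

lemma scramble_less:
  "\<omega> \<in> space M \<Longrightarrow> set w \<subseteq> {..<c j} \<Longrightarrow> s < c j \<Longrightarrow> P j w \<omega> s < c j"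
  using permutes_in_image[OF scramble_permutes, of \<omega> w j s] by simp

lemma measurable_restrict_perm:
  assumes "J \<subseteq> index" "finite J"
  shows "(\<lambda>\<omega>. restrict (perm \<omega>) J) \<in> M \<rightarrow>\<^sub>M count_space (PiE J perms)"
proof -
  have "(\<lambda>\<omega>. restrict (perm \<omega>) J) \<in> M \<rightarrow>\<^sub>M PiM J (\<lambda>i. count_space (perms i))"
    using assms(1) by (intro measurable_restrict measurable_perm) auto
  then show ?thesis
    using assms(2) finite_perms by (subst (asm) count_space_PiM_finite) (auto intro: countable_finite)
qed

text \<open>
  Quantities computed from a scramble consult finitely many of its permutations. Keeping track of
  which ones gives integrability and independence without further measure theory.
\<close>

definition depends_on :: "(('n \<times> nat list \<Rightarrow> nat \<Rightarrow> nat) \<Rightarrow> 'b) \<Rightarrow> ('n \<times> nat list) set \<Rightarrow> bool" where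
  "depends_on V J \<longleftrightarrow> (\<forall>\<sigma> \<sigma>'. (\<forall>i\<in>J. \<sigma> i = \<sigma>' i) \<longrightarrow> V \<sigma> = V \<sigma>')"

lemma depends_on_restrict: "depends_on V J \<Longrightarrow> V (restrict \<sigma> J) = V \<sigma>"
  unfolding depends_on_def by auto

lemma integrable_depends_on:
  fixes V :: "('n \<times> nat list \<Rightarrow> nat \<Rightarrow> nat) \<Rightarrow> real"
  assumes "J \<subseteq> index" "finite J" "depends_on V J"
  shows "integrable M (\<lambda>\<omega>. V (perm \<omega>))"
proof (rule integrable_const_bound[where B = "\<Sum>g\<in>PiE J perms. \<bar>V g\<bar>"])
  have V: "V (perm \<omega>) = V (restrict (perm \<omega>) J)" for \<omega>
    using depends_on_restrict[OF assms(3)] by simp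
  note m = measurable_restrict_perm[OF assms(1,2)]
  show "AE \<omega> in M. norm (V (perm \<omega>)) \<le> (\<Sum>g\<in>PiE J perms. \<bar>V g\<bar>)"
  proof (rule AE_I2)
    fix \<omega> assume "\<omega> \<in> space M"
    then have mem: "restrict (perm \<omega>) J \<in> PiE J perms" using measurable_space[OF m] by simp
    show "norm (V (perm \<omega>)) \<le> (\<Sum>g\<in>PiE J perms. \<bar>V g\<bar>)"
      unfolding V real_norm_def using assms(2) finite_perms
      by (intro member_le_sum[OF mem] finite_PiE) auto
  qed
  have "V \<circ> (\<lambda>\<omega>. restrict (perm \<omega>) J) \<in> borel_measurable M"
    by (rule measurable_comp[OF m]) simp
  then show "(\<lambda>\<omega>. V (perm \<omega>)) \<in> borel_measurable M" by (simp add: o_def V[symmetric])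
qed

lemma expectation_mult_independent:
  fixes U :: "(nat \<Rightarrow> nat) \<Rightarrow> real" and V :: "('n \<times> nat list \<Rightarrow> nat \<Rightarrow> nat) \<Rightarrow> real"
  assumes i: "i \<in> index" and J: "J \<subseteq> index" "finite J" "i \<notin> J" and V: "depends_on V J"
  shows "expectation (\<lambda>\<omega>. U (perm \<omega> i) * V (perm \<omega>))
       = expectation (\<lambda>\<omega>. U (perm \<omega> i)) * expectation (\<lambda>\<omega>. V (perm \<omega>))"
proof (rule indep_var_lebesgue_integral)
  let ?C = "\<lambda>i. count_space (perms i)"
  have PiM: "PiM A ?C = count_space (PiE A perms)" if "finite A" for A
    using that finite_perms by (intro count_space_PiM_finite) (auto intro: countable_finite)
  have "indep_var (PiM {i} ?C) (\<lambda>\<omega>. restrict (\<lambda>i. perm \<omega> i) {i}) (PiM J ?C) (\<lambda>\<omega>. restrict (\<lambda>i. perm \<omega> i) J)"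
    using i J by (intro indep_var_restrict[OF indep_perm]) auto
  then have "indep_var borel ((\<lambda>g. U (g i)) \<circ> (\<lambda>\<omega>. restrict (\<lambda>i. perm \<omega> i) {i}))
      borel (V \<circ> (\<lambda>\<omega>. restrict (\<lambda>i. perm \<omega> i) J))"
    using J(2) by (intro indep_var_compose[of "PiM {i} ?C" _ "PiM J ?C"]) (simp_all add: PiM)
  then show "indep_var borel (\<lambda>\<omega>. U (perm \<omega> i)) borel (\<lambda>\<omega>. V (perm \<omega>))"
    by (simp add: o_def depends_on_restrict[OF V])
  show "integrable M (\<lambda>\<omega>. U (perm \<omega> i))"
    using i by (intro integrable_depends_on[of "{i}" "\<lambda>\<sigma>. U (\<sigma> i)"]) (auto simp: depends_on_def)
  show "integrable M (\<lambda>\<omega>. V (perm \<omega>))"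
    by (rule integrable_depends_on[OF J(1,2) V])
qed

text \<open>
  The pair \<open>(\<pi> x, \<pi> y)\<close> with \<open>y \<noteq> x\<close> is uniform on \<open>c (c - 1)\<close> values, of which \<open>c - 1\<close> have first entry \<open>s\<close>.
\<close>

lemma digit_uniform:
  assumes i: "i \<in> index" and x: "x < c (fst i)" and s: "s < c (fst i)"
  shows "expectation (\<lambda>\<omega>. if perm \<omega> i x = s then 1 else 0) = 1 / real (c (fst i))"
proof -
  obtain j w where jw: "i = (j, w)" by (cases i)
  let ?c = "c j"
  have w: "set w \<subseteq> {..<?c}" using i by (simp add: jw index_def)
  have x: "x < ?c" and s: "s < ?c" using x s by (simp_all add: jw)
  obtain y where y: "y < ?c" "y \<noteq> x"
  proof (cases "x = 0")
    case True
    show ?thesis using that[of 1] base[of j] True by simp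
  next
    case False
    show ?thesis using that[of 0] base[of j] False by simp
  qed
  let ?D = "{(p, q). p < ?c \<and> q < ?c \<and> p \<noteq> q}"
  have fin: "finite ?D" by (rule finite_subset[of _ "{..<?c} \<times> {..<?c}"]) auto
  have m: "(\<lambda>\<omega>. (P j w \<omega> x, P j w \<omega> y)) \<in> M \<rightarrow>\<^sub>M count_space ?D"
  proof -
    have "(\<lambda>\<sigma>. (\<sigma> x, \<sigma> y)) \<in> perms i \<rightarrow> ?D"
    proof
      fix \<sigma> assume "\<sigma> \<in> perms i"
      then have \<sigma>: "\<sigma> permutes {..<?c}" by (simp add: jw)
      then show "(\<sigma> x, \<sigma> y) \<in> ?D"
        using x y permutes_in_image[OF \<sigma>, of x] permutes_in_image[OF \<sigma>, of y] permutes_inj[OF \<sigma>]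
        by (simp add: inj_eq)
    qed
    then have "(\<lambda>\<sigma>. (\<sigma> x, \<sigma> y)) \<circ> (\<lambda>\<omega>. perm \<omega> i) \<in> M \<rightarrow>\<^sub>M count_space ?D"
      by (intro measurable_comp[OF measurable_perm[OF i]]) simp
    then show ?thesis by (simp add: o_def jw perm_def)
  qed
  let ?E = "{z \<in> ?D. fst z = s}"
  have d: "distr M (count_space ?D) (\<lambda>\<omega>. (P j w \<omega> x, P j w \<omega> y)) = uniform_count_measure ?D"
    using uniform w x y unfolding two_fold_uniform_def by auto
  have "expectation (\<lambda>\<omega>. if perm \<omega> i x = s then 1 else 0)
      = expectation (indicator ((\<lambda>\<omega>. (P j w \<omega> x, P j w \<omega> y)) -` ?E \<inter> space M))"
    using measurable_space[OF m] by (intro Bochner_Integration.integral_cong) (auto simp: jw perm_def indicator_def)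
  also have "\<dots> = measure M ((\<lambda>\<omega>. (P j w \<omega> x, P j w \<omega> y)) -` ?E \<inter> space M)"
    by simp
  also have "\<dots> = measure (distr M (count_space ?D) (\<lambda>\<omega>. (P j w \<omega> x, P j w \<omega> y))) ?E"
    by (rule measure_distr[OF m, symmetric]) auto
  also have "\<dots> = card ?E / card ?D"
    unfolding d by (rule measure_uniform_count_measure[OF fin]) auto
  also have "card ?D = ?c * (?c - 1)"
  proof -
    have "?D = {..<?c} \<times> {..<?c} - (\<lambda>p. (p, p)) ` {..<?c}" by auto
    then have "card ?D = card ({..<?c} \<times> {..<?c}) - card ((\<lambda>p. (p, p)) ` {..<?c})"
      by (simp only:) (rule card_Diff_subset, auto)
    also have "card ((\<lambda>p. (p, p)) ` {..<?c}) = ?c" by (subst card_image) (auto simp: inj_on_def)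
    finally show ?thesis by (simp add: right_diff_distrib')
  qed
  also have "card ?E = ?c - 1"
  proof -
    have "?E = (\<lambda>q. (s, q)) ` ({..<?c} - {s})" using s by auto
    then have "card ?E = card ({..<?c} - {s})" by (simp only:) (rule card_image, auto simp: inj_on_def)
    then show ?thesis using s by simp
  qed
  also have "real (?c - 1) / real (?c * (?c - 1)) = 1 / real ?c" using base[of j] by simp
  finally show ?thesis by (simp add: jw)
qed

definition words_below :: "nat \<Rightarrow> ('n \<times> nat list) set" where
  "words_below N = {(j, w). set w \<subseteq> {..<c j} \<and> length w < N}"

lemma words_below_subset: "words_below N \<subseteq> index"
  by (auto simp: words_below_def index_def)

lemma finite_words_below: "finite (words_below N)"
proof -
  have "words_below N \<subseteq> (SIGMA j:UNIV. {w. set w \<subseteq> {..<c j} \<and> length w \<le> N})"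
    by (auto simp: words_below_def)
  then show ?thesis by (rule finite_subset) (auto intro!: finite_SigmaI finite_lists_length_le)
qed

lemma depends_on_scrambled_cells:
  assumes "\<And>j r. r < k j \<Longrightarrow> (j, word (c j) r (a j div c j ^ (k j - r))) \<in> J"
  shows "depends_on (\<lambda>\<sigma>. scrambled_cells c (curry \<sigma>) k a) J"
  unfolding depends_on_def scrambled_cells_def
  using assms by (auto simp: fun_eq_iff intro!: scramble_cell_cong)

lemma word_in_words_below: "r < N \<Longrightarrow> (j, word (c j) r a) \<in> words_below N"
  using set_word[OF base_pos] by (auto simp: words_below_def)

lemma depends_on_words_below:
  assumes "\<And>j. k j \<le> N"
  shows "depends_on (\<lambda>\<sigma>. scrambled_cells c (curry \<sigma>) k a) (words_below N)"
  using assms by (intro depends_on_scrambled_cells word_in_words_below) (meson less_le_trans)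

lemma integrable_scrambled_cells:
  fixes h :: "('n \<Rightarrow> nat) \<Rightarrow> ('n \<Rightarrow> nat) \<Rightarrow> real"
  shows "integrable M (\<lambda>\<omega>. h (scrambled_cells c (\<lambda>j w. P j w \<omega>) k a) (scrambled_cells c (\<lambda>j w. P j w \<omega>) l a'))"
proof -
  define N where "N = (\<Sum>j\<in>UNIV. k j + l j)"
  have "k j + l j \<le> N" for j unfolding N_def by (rule member_le_sum) auto
  then have "k j \<le> N" "l j \<le> N" for j by (meson add_leE)+
  then have "depends_on (\<lambda>\<sigma>. h (scrambled_cells c (curry \<sigma>) k a) (scrambled_cells c (curry \<sigma>) l a')) (words_below N)"
    using depends_on_words_below[of k N a] depends_on_words_below[of l N a'] unfolding depends_on_def by metis
  from integrable_depends_on[OF words_below_subset finite_words_below this]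
  show ?thesis by (simp add: curry_perm)
qed

text \<open>
  The source of all orthogonality. The last digit of the scrambled \<open>a\<close> in direction \<open>j\<close> is produced by
  the permutation attached to the first \<open>q\<close> digits of \<open>a j\<close>. Scrambling \<open>a'\<close> consults this permutation only
  if it reaches level \<open>q + 1\<close> and passes through the same prefix, which the hypothesis
  \<open>fresh\<close> excludes. So this digit is uniform and independent of everything else in the product, and
  averaging over it makes \<open>G\<close> vanish.
\<close>

lemma fresh_digit_orthogonal:
  fixes G H :: "('n \<Rightarrow> nat) \<Rightarrow> real"
  assumes centred: "\<And>a r. (\<Sum>s<c j. G (a(j := r * c j + s))) = 0"
    and q: "k j = Suc q" and a: "a j < c j ^ k j" and a': "a' j < c j ^ l j"
    and fresh: "l j \<le> q \<or> a j div c j \<noteq> a' j div c j ^ (l j - q)"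
  shows "expectation (\<lambda>\<omega>. G (scrambled_cells c (\<lambda>j w. P j w \<omega>) k a) *
                           H (scrambled_cells c (\<lambda>j w. P j w \<omega>) l a')) = 0"
proof -
  define N where "N = (\<Sum>j\<in>UNIV. k j + l j)"
  have "k j + l j \<le> N" for j unfolding N_def by (rule member_le_sum) auto
  then have N: "k j \<le> N" "l j \<le> N" for j by (meson add_leE)+
  define i where "i = (j, word (c j) q (a j div c j))"
  define x where "x = a j mod c j"
  define J where "J = words_below N - {i}"
  define R where "R \<sigma> = scramble_cell (c j) (curry \<sigma> j) q (a j div c j)" for \<sigma> :: "'n \<times> nat list \<Rightarrow> nat \<Rightarrow> nat"
  \<comment> \<open>the product with \<open>s\<close> in place of the random last digit\<close>
  define V where "V s \<sigma> = G ((scrambled_cells c (curry \<sigma>) k a)(j := R \<sigma> * c j + s)) * H (scrambled_cells c (curry \<sigma>) l a')"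
    for s and \<sigma> :: "'n \<times> nat list \<Rightarrow> nat \<Rightarrow> nat"
  have i: "i \<in> index" using set_word[OF base_pos] by (auto simp: i_def index_def)
  have J: "J \<subseteq> index" "finite J" "i \<notin> J"
    using words_below_subset finite_words_below by (auto simp: J_def)
  have V: "depends_on (V s) J" for s
  proof -
    have 1: "R \<sigma> = R \<sigma>'" if "\<forall>i\<in>J. \<sigma> i = \<sigma>' i" for \<sigma> \<sigma>'
      unfolding R_def
    proof (rule scramble_cell_cong)
      fix r assume "r < q"
      then have "(j, word (c j) r (a j div c j div c j ^ (q - r))) \<in> J"
        using word_in_words_below[of r N j] N(1)[of j] q
        by (auto simp: J_def i_def dest: arg_cong[of _ _ length])
      then show "curry \<sigma> j (word (c j) r (a j div c j div c j ^ (q - r))) =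
            curry \<sigma>' j (word (c j) r (a j div c j div c j ^ (q - r)))"
        using that by simp
    qed
    have "(scrambled_cells c (curry \<sigma>) k a) j' = (scrambled_cells c (curry \<sigma>') k a) j'"
      if "\<forall>i\<in>J. \<sigma> i = \<sigma>' i" "j' \<noteq> j" for \<sigma> \<sigma>' j'
      unfolding scrambled_cells_def
    proof (rule scramble_cell_cong)
      fix r assume "r < k j'"
      then have "(j', word (c j') r (a j' div c j' ^ (k j' - r))) \<in> J"
        using word_in_words_below[of r N j'] N(1)[of j'] that(2) by (auto simp: J_def i_def)
      then show "curry \<sigma> j' (word (c j') r (a j' div c j' ^ (k j' - r))) =
            curry \<sigma>' j' (word (c j') r (a j' div c j' ^ (k j' - r)))"
        using that by simp
    qed
    then have 2: "(scrambled_cells c (curry \<sigma>) k a)(j := t) = (scrambled_cells c (curry \<sigma>') k a)(j := t)"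
      if "\<forall>i\<in>J. \<sigma> i = \<sigma>' i" for \<sigma> \<sigma>' t
      using that by (auto simp: fun_eq_iff)
    have 3: "depends_on (\<lambda>\<sigma>. scrambled_cells c (curry \<sigma>) l a') J"
    proof (rule depends_on_scrambled_cells)
      fix j' r assume r: "r < l j'"
      have "(j', word (c j') r (a' j' div c j' ^ (l j' - r))) \<noteq> i"
      proof
        assume "(j', word (c j') r (a' j' div c j' ^ (l j' - r))) = i"
        then have j': "j' = j" and w: "word (c j) r (a' j div c j ^ (l j - r)) = word (c j) q (a j div c j)"
          by (auto simp: i_def)
        have "r = q" using arg_cong[OF w, of length] by simp
        have "c j ^ l j = c j ^ q * c j ^ (l j - q)" using r j' \<open>r = q\<close> by (simp flip: power_add)
        then have "a' j div c j ^ (l j - q) < c j ^ q"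
          using a' by (simp add: less_mult_imp_div_less)
        moreover have "a j div c j < c j ^ q" using a q by (simp add: less_mult_imp_div_less mult.commute)
        ultimately have "a' j div c j ^ (l j - q) = a j div c j"
          using w \<open>r = q\<close> word_inject by blast
        then show False using fresh r j' \<open>r = q\<close> by simp
      qed
      then show "(j', word (c j') r (a' j' div c j' ^ (l j' - r))) \<in> J"
        using word_in_words_below[of r N j'] N(2)[of j'] r by (auto simp: J_def)
    qed
    show ?thesis
      unfolding depends_on_def
    proof (intro allI impI)
      fix \<sigma> \<sigma>' :: "'n \<times> nat list \<Rightarrow> nat \<Rightarrow> nat" assume *: "\<forall>i\<in>J. \<sigma> i = \<sigma>' i"
      have "scrambled_cells c (curry \<sigma>) l a' = scrambled_cells c (curry \<sigma>') l a'"
        using 3 * unfolding depends_on_def by (elim allE impE)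
      then show "V s \<sigma> = V s \<sigma>'" unfolding V_def 1[OF *] 2[OF *] by simp
    qed
  qed
  have x: "x < c j" using base_pos by (simp add: x_def)
  \<comment> \<open>subtracting \<open>1 / c\<close> is free, as the \<open>V s\<close> add up to zero, and makes the factor centred\<close>
  let ?g = "\<lambda>s. \<lambda>\<sigma>. (if \<sigma> x = s then 1 else 0) - 1 / real (c j)"
  have E0: "expectation (\<lambda>\<omega>. ?g s (perm \<omega> i)) = 0" if "s < c j" for s
  proof -
    have "integrable M (\<lambda>\<omega>. (if perm \<omega> i x = s then 1 else 0 :: real))"
      using i by (intro integrable_depends_on[of "{i}" "\<lambda>\<sigma>. if \<sigma> i x = s then 1 else 0"]) (auto simp: depends_on_def)
    then show ?thesis using digit_uniform[OF i, of x s] x that by (simp add: i_def prob_space)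
  qed
  have "expectation (\<lambda>\<omega>. G (scrambled_cells c (\<lambda>j w. P j w \<omega>) k a) * H (scrambled_cells c (\<lambda>j w. P j w \<omega>) l a'))
      = expectation (\<lambda>\<omega>. \<Sum>s<c j. ?g s (perm \<omega> i) * V s (perm \<omega>))"
  proof (rule Bochner_Integration.integral_cong[OF refl])
    fix \<omega> assume \<omega>: "\<omega> \<in> space M"
    have "perm \<omega> i x < c j"
      using permutes_in_image[OF perm_permutes[OF \<omega> i], of x] x by (simp add: i_def)
    then have "(\<Sum>s<c j. (if perm \<omega> i x = s then 1 else 0) * V s (perm \<omega>)) = V (perm \<omega> i x) (perm \<omega>)"
      by (simp add: if_distrib[of "\<lambda>t. t * _"] cong: if_cong)
    moreover have "(\<Sum>s<c j. V s (perm \<omega>)) = 0"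
      using centred by (simp add: V_def flip: sum_distrib_right)
    ultimately have "(\<Sum>s<c j. ?g s (perm \<omega> i) * V s (perm \<omega>)) = V (perm \<omega> i x) (perm \<omega>)"
      by (simp add: left_diff_distrib sum_subtractf flip: sum_divide_distrib)
    moreover have "(scrambled_cells c (\<lambda>j w. P j w \<omega>) k a)(j := R (perm \<omega>) * c j + perm \<omega> i x)
        = scrambled_cells c (\<lambda>j w. P j w \<omega>) k a"
      by (auto simp: fun_eq_iff scrambled_cells_def q R_def i_def x_def perm_def)
    ultimately show "G (scrambled_cells c (\<lambda>j w. P j w \<omega>) k a) * H (scrambled_cells c (\<lambda>j w. P j w \<omega>) l a')
      = (\<Sum>s<c j. ?g s (perm \<omega> i) * V s (perm \<omega>))"
      by (simp add: V_def curry_perm)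
  qed
  also have "\<dots> = (\<Sum>s<c j. expectation (\<lambda>\<omega>. ?g s (perm \<omega> i) * V s (perm \<omega>)))"
  proof (rule Bochner_Integration.integral_sum)
    fix s
    have "depends_on (\<lambda>\<sigma>. ?g s (\<sigma> i) * V s \<sigma>) (insert i J)"
      using V[of s] unfolding depends_on_def by (metis insertCI)
    then show "integrable M (\<lambda>\<omega>. ?g s (perm \<omega> i) * V s (perm \<omega>))"
      using i J by (intro integrable_depends_on[of "insert i J" "\<lambda>\<sigma>. ?g s (\<sigma> i) * V s \<sigma>"]) auto
  qed
  also have "\<dots> = 0"
    using E0 by (intro sum.neutral ballI) (simp add: expectation_mult_independent[OF i J V, of "?g _"])
  finally show ?thesis .
qed

text \<open>
  Digits of different index use permutations with prefixes of different length, hence independent ones;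
  each digit takes a prescribed value with probability \<open>1 / c\<close>.
\<close>

lemma expectation_scramble_cell_eq_le:
  "expectation (\<lambda>\<omega>. if scramble_cell (c j) (\<lambda>w. P j w \<omega>) k a = v then 1 else 0) \<le> 1 / real (c j) ^ k"
proof (induction k arbitrary: a v)
  case 0
  show ?case by (simp add: prob_space)
next
  case (Suc k)
  let ?c = "c j"
  define i where "i = (j, word ?c k (a div ?c))"
  define U where "U = (\<lambda>\<sigma>. if \<sigma> (a mod ?c) = v mod ?c then 1 else 0 :: real)"
  define V where "V = (\<lambda>\<sigma>. if scramble_cell ?c (curry \<sigma> j) k (a div ?c) = v div ?c then 1 else 0 :: real)"
  have i: "i \<in> index" using set_word[OF base_pos] by (auto simp: i_def index_def)
  have J: "words_below k \<subseteq> index" "finite (words_below k)" "i \<notin> words_below k"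
    using words_below_subset finite_words_below by (auto simp: i_def words_below_def)
  have V: "depends_on V (words_below k)"
    unfolding depends_on_def
  proof (intro allI impI)
    fix \<sigma> \<sigma>' :: "'n \<times> nat list \<Rightarrow> nat \<Rightarrow> nat" assume "\<forall>i\<in>words_below k. \<sigma> i = \<sigma>' i"
    then have "scramble_cell ?c (curry \<sigma> j) k (a div ?c) = scramble_cell ?c (curry \<sigma>' j) k (a div ?c)"
      using word_in_words_below by (intro scramble_cell_cong) auto
    then show "V \<sigma> = V \<sigma>'" by (simp add: V_def)
  qed
  have dep: "depends_on (\<lambda>\<sigma>. U (\<sigma> i) * V \<sigma>) (insert i (words_below k))"
    using V unfolding depends_on_def by (metis insertCI)
  have "expectation (\<lambda>\<omega>. if scramble_cell ?c (\<lambda>w. P j w \<omega>) (Suc k) a = v then 1 else 0)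
      = expectation (\<lambda>\<omega>. U (perm \<omega> i) * V (perm \<omega>))"
  proof (rule Bochner_Integration.integral_cong[OF refl])
    fix \<omega> assume \<omega>: "\<omega> \<in> space M"
    have "P j (word ?c k (a div ?c)) \<omega> (a mod ?c) < ?c"
      using base_pos set_word by (intro scramble_less[OF \<omega>]) auto
    then have "scramble_cell ?c (\<lambda>w. P j w \<omega>) (Suc k) a = v \<longleftrightarrow>
      scramble_cell ?c (\<lambda>w. P j w \<omega>) k (a div ?c) = v div ?c \<and> P j (word ?c k (a div ?c)) \<omega> (a mod ?c) = v mod ?c"
      using base_pos[of j] by auto
    then show "(if scramble_cell ?c (\<lambda>w. P j w \<omega>) (Suc k) a = v then 1 else 0) = U (perm \<omega> i) * V (perm \<omega>)"
      by (simp add: U_def V_def curry_perm i_def perm_def del: scramble_cell.simps)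
  qed
  also have "\<dots> = expectation (\<lambda>\<omega>. U (perm \<omega> i)) * expectation (\<lambda>\<omega>. V (perm \<omega>))"
    by (rule expectation_mult_independent[OF i J V])
  also have "expectation (\<lambda>\<omega>. U (perm \<omega> i)) = 1 / real ?c"
    unfolding U_def using digit_uniform[OF i, of "a mod ?c" "v mod ?c"] base_pos by (simp add: i_def)
  also have "expectation (\<lambda>\<omega>. V (perm \<omega>)) \<le> 1 / real ?c ^ k"
    unfolding V_def curry_perm by (rule Suc.IH)
  finally show ?case by (simp add: divide_right_mono)
qed

end

section \<open>The second moment of the mean over the grid\<close>

locale scrambled_net = coarse_scramble M "\<lambda>j. b ^ e j" P
  for M :: "'w measure" and b :: nat and e :: "'n::finite \<Rightarrow> nat" and P :: "'n \<Rightarrow> nat list \<Rightarrow> 'w \<Rightarrow> nat \<Rightarrow> nat" +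
  fixes x :: "nat \<Rightarrow> real ^ 'n"
  assumes net: "zero_e_sequence b e x" and b: "2 \<le> b"
begin

abbreviation c :: "'n \<Rightarrow> nat" where
  "c \<equiv> \<lambda>j. b ^ e j"

definition scrambled :: "('n \<Rightarrow> nat) \<Rightarrow> nat \<Rightarrow> 'w \<Rightarrow> 'n \<Rightarrow> nat" where
  "scrambled k i \<omega> = scrambled_cells c (\<lambda>j w. P j w \<omega>) k (cells c k (x i))"

lemma point_in_cube: "x i \<in> unit_cube"
  using net by (simp add: zero_e_sequence_def)

lemma cells_less: "cells c k (x i) j < c j ^ k j"
  unfolding cells_def using point_in_cube[of i] base_pos by (intro cell_less) (auto simp: unit_cube_def)

lemma scrambled_less: "\<omega> \<in> space M \<Longrightarrow> scrambled k i \<omega> j < c j ^ k j"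
  unfolding scrambled_def scrambled_cells_def
  by (rule scramble_cell_less[OF base_pos scramble_less])

lemma scrambled_coarser:
  assumes "\<omega> \<in> space M" "\<And>j. k j \<le> K"
  shows "scrambled k i \<omega> = (\<lambda>j. scrambled (\<lambda>_. K) i \<omega> j div c j ^ (K - k j))"
proof
  fix j
  have "scrambled (\<lambda>_. K) i \<omega> j div c j ^ (K - k j)
      = scramble_cell (c j) (\<lambda>w. P j w \<omega>) (k j) (cells c (\<lambda>_. K) (x i) j div c j ^ (K - k j))"
    unfolding scrambled_def scrambled_cells_def
    by (rule scramble_cell_div[OF base_pos scramble_less[OF assms(1)] assms(2)])
  also have "cells c (\<lambda>_. K) (x i) j div c j ^ (K - k j) = cells c k (x i) j"
    using fun_cong[OF cells_coarser[where c = c, OF point_in_cube[of i] base_pos, of k "\<lambda>_. K"], of j] assms(2)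
    by simp
  finally show "scrambled k i \<omega> j = scrambled (\<lambda>_. K) i \<omega> j div c j ^ (K - k j)"
    by (simp add: scrambled_def scrambled_cells_def)
qed

lemma integrable_scrambled:
  fixes G H :: "('n \<Rightarrow> nat) \<Rightarrow> real"
  shows "integrable M (\<lambda>\<omega>. G (scrambled k i \<omega>) * H (scrambled l i' \<omega>))"
  unfolding scrambled_def by (rule integrable_scrambled_cells[of "\<lambda>a a'. G a * H a'"])

text \<open>
  If the two levels differ in direction \<open>j\<close>, the last digit of the finer one in that direction is beyond the
  reach of the coarser one.
\<close>

lemma components_orthogonal:
  assumes "k \<noteq> l" "\<And>j. k j \<le> K" "\<And>j. l j \<le> K"
  shows "expectation (\<lambda>\<omega>. component c K f k (scrambled k i \<omega>) * component c K f l (scrambled l i' \<omega>)) = 0"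
proof -
  have *: "expectation (\<lambda>\<omega>. component c K f k' (scrambled k' h \<omega>) * component c K f l' (scrambled l' h' \<omega>)) = 0"
    if "l' j < k' j" "\<And>j. k' j \<le> K" for k' l' j h h'
  proof -
    from that(1) obtain q where q: "k' j = Suc q" "l' j \<le> q" by (cases "k' j") auto
    show ?thesis unfolding scrambled_def
    proof (rule fresh_digit_orthogonal)
      show "(\<Sum>s<c j. component c K f k' (a(j := r * c j + s))) = 0" for a r
        by (rule sum_component_digit[where c = c and j = j and k = k', OF base_pos q(1) that(2)])
    qed (rule cells_less | simp add: q)+
  qed
  from assms(1) obtain j where "k j \<noteq> l j" by auto
  then consider "l j < k j" | "k j < l j" by linarith
  then show ?thesis
  proof cases
    case 1
    show ?thesis using *[of l j k] 1 assms(2) by simp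
  next
    case 2
    have "expectation (\<lambda>\<omega>. component c K f l (scrambled l i' \<omega>) * component c K f k (scrambled k i \<omega>)) = 0"
      using *[of k j l] 2 assms(3) by simp
    then show ?thesis by (simp add: mult.commute)
  qed
qed

text \<open>
  If the points separate before their last digits in direction \<open>j\<close>, these last digits are produced by
  different permutations.
\<close>

lemma distant_points_uncorrelated:
  assumes far: "cells c (\<lambda>j. k j - 1) (x i) \<noteq> cells c (\<lambda>j. k j - 1) (x i')" and k: "\<And>j. k j \<le> K"
  shows "expectation (\<lambda>\<omega>. component c K f k (scrambled k i \<omega>) * component c K f k (scrambled k i' \<omega>)) = 0"
proof -
  from far obtain j where j: "cell (c j) (k j - 1) (x i $ j) \<noteq> cell (c j) (k j - 1) (x i' $ j)"
    by (auto simp: cells_def fun_eq_iff)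
  have x01: "0 \<le> x i $ j" "x i $ j < 1" for i using point_in_cube[of i] by (auto simp: unit_cube_def)
  have "k j \<noteq> 0"
  proof
    assume "k j = 0"
    have "cell (c j) 0 (x i $ j) = 0" for i using x01[of i] cell_less[of "x i $ j" "c j" 0] base_pos by simp
    then show False using j \<open>k j = 0\<close> by simp
  qed
  then obtain q where q: "k j = Suc q" by (cases "k j") auto
  show ?thesis unfolding scrambled_def
  proof (rule fresh_digit_orthogonal)
    show "(\<Sum>s<c j. component c K f k (a(j := r * c j + s))) = 0" for a r
      by (rule sum_component_digit[where c = c and j = j and k = k, OF base_pos q k])
    show "k j \<le> q \<or> cells c k (x i) j div c j \<noteq> cells c k (x i') j div c j ^ (k j - q)"
      using j q cell_div[OF x01(1) base_pos, of _ q] by (simp add: cells_def)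
  qed (rule cells_less | simp add: q)+
qed

definition component_mean :: "nat \<Rightarrow> nat \<Rightarrow> (real ^ 'n \<Rightarrow> real) \<Rightarrow> ('n \<Rightarrow> nat) \<Rightarrow> 'w \<Rightarrow> real" where
  "component_mean m K f k \<omega> = 1 / real (b ^ m) * (\<Sum>i<b ^ m. component c K f k (scrambled k i \<omega>))"

lemma component_mean_mult:
  "component_mean m K f k \<omega> * component_mean m K f l \<omega>
   = (\<Sum>i<b ^ m. \<Sum>i'<b ^ m. (1 / real (b ^ m))\<^sup>2 *
        (component c K f k (scrambled k i \<omega>) * component c K f l (scrambled l i' \<omega>)))"
  unfolding component_mean_def power2_eq_square
  by (subst sum.swap) (simp add: sum_product sum_distrib_left mult_ac)

lemma integrable_component_mean_mult:
  "integrable M (\<lambda>\<omega>. component_mean m K f k \<omega> * component_mean m K f l \<omega>)"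
  unfolding component_mean_mult
  by (intro Bochner_Integration.integrable_sum integrable_mult_right integrable_scrambled)

lemma expectation_component_mean_mult:
  "expectation (\<lambda>\<omega>. component_mean m K f k \<omega> * component_mean m K f l \<omega>)
   = (\<Sum>i<b ^ m. \<Sum>i'<b ^ m. (1 / real (b ^ m))\<^sup>2 *
        expectation (\<lambda>\<omega>. component c K f k (scrambled k i \<omega>) * component c K f l (scrambled l i' \<omega>)))"
  unfolding component_mean_mult
  by (simp add: Bochner_Integration.integral_sum integrable_scrambled integrable_mult_right)

lemma component_means_orthogonal:
  assumes "k \<noteq> l" "\<And>j. k j \<le> K" "\<And>j. l j \<le> K"
  shows "expectation (\<lambda>\<omega>. component_mean m K f k \<omega> * component_mean m K f l \<omega>) = 0"
  unfolding expectation_component_mean_mult using components_orthogonal[OF assms] by simp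

text \<open>
  Of the \<open>n\<^sup>2\<close> pairs of points, where \<open>n = b ^ m\<close>, only \<open>O(n)\<close> interact, and each contributes at most \<open>\<beta>\<^sup>2\<close>.
\<close>

lemma component_mean_second_moment:
  assumes k: "\<And>j. k j \<le> K" and gt: "(\<Sum>j\<in>UNIV. e j * k j) > m"
    and \<beta>: "\<And>a. (\<And>j. a j < c j ^ k j) \<Longrightarrow> \<bar>component c K f k a\<bar> \<le> \<beta>"
  shows "expectation (\<lambda>\<omega>. component_mean m K f k \<omega> * component_mean m K f k \<omega>)
         \<le> real (b ^ (\<Sum>j\<in>UNIV. e j)) * \<beta>\<^sup>2 / real (b ^ m)"
proof -
  let ?n = "b ^ m" and ?h = "b ^ (\<Sum>j\<in>UNIV. e j)"
  let ?E = "\<lambda>i i'. expectation (\<lambda>\<omega>. component c K f k (scrambled k i \<omega>) * component c K f k (scrambled k i' \<omega>))"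
  let ?near = "\<lambda>i. {i'. i' < ?n \<and> cells c (\<lambda>j. k j - 1) (x i') = cells c (\<lambda>j. k j - 1) (x i)}"
  have n: "real ?n > 0" using b by simp
  have E: "?E i i' \<le> \<beta>\<^sup>2" for i i'
  proof -
    have "?E i i' \<le> expectation (\<lambda>_. \<beta>\<^sup>2)"
    proof (intro integral_mono integrable_scrambled)
      fix \<omega> assume \<omega>: "\<omega> \<in> space M"
      have "\<bar>component c K f k (scrambled k i \<omega>)\<bar> * \<bar>component c K f k (scrambled k i' \<omega>)\<bar> \<le> \<beta> * \<beta>"
        using scrambled_less[OF \<omega>] by (intro mult_mono \<beta>) (auto intro: order_trans[OF abs_ge_zero \<beta>])
      then show "component c K f k (scrambled k i \<omega>) * component c K f k (scrambled k i' \<omega>) \<le> \<beta>\<^sup>2"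
        unfolding power2_eq_square abs_mult[symmetric] by linarith
    qed simp
    then show ?thesis by (simp add: prob_space)
  qed
  have "(\<Sum>i'<?n. ?E i i') \<le> real ?h * \<beta>\<^sup>2" for i
  proof -
    have "(\<Sum>i'<?n. ?E i i') = (\<Sum>i'\<in>?near i. ?E i i')"
    proof (rule sum.mono_neutral_right)
      show "\<forall>i'\<in>{..<?n} - ?near i. ?E i i' = 0"
      proof
        fix i' assume "i' \<in> {..<?n} - ?near i"
        then have "cells c (\<lambda>j. k j - 1) (x i) \<noteq> cells c (\<lambda>j. k j - 1) (x i')" by auto
        then show "?E i i' = 0" by (rule distant_points_uncorrelated[OF _ k])
      qed
    qed auto
    also have "\<dots> \<le> (\<Sum>i'\<in>?near i. \<beta>\<^sup>2)" by (intro sum_mono E)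
    also have "\<dots> = real (card (?near i)) * \<beta>\<^sup>2" by simp
    also have "\<dots> \<le> real ?h * \<beta>\<^sup>2"
      using card_close_points[OF net _ gt, of i] b by (intro mult_right_mono) auto
    finally show ?thesis .
  qed
  then have "(\<Sum>i<?n. \<Sum>i'<?n. ?E i i') \<le> (\<Sum>i<?n. real ?h * \<beta>\<^sup>2)" by (intro sum_mono)
  then have "(1 / real ?n)\<^sup>2 * (\<Sum>i<?n. \<Sum>i'<?n. ?E i i') \<le> (1 / real ?n)\<^sup>2 * (\<Sum>i<?n. real ?h * \<beta>\<^sup>2)"
    by (rule mult_left_mono) simp
  also have "\<dots> = real ?h * \<beta>\<^sup>2 / real ?n"
    using n by (simp add: power2_eq_square)
  finally show ?thesis
    unfolding expectation_component_mean_mult by (simp add: sum_distrib_left)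
qed

definition grid_mean :: "nat \<Rightarrow> nat \<Rightarrow> (real ^ 'n \<Rightarrow> real) \<Rightarrow> 'w \<Rightarrow> real" where
  "grid_mean m K f \<omega> = 1 / real (b ^ m) * (\<Sum>i<b ^ m. f (grid_point c K (scrambled (\<lambda>_. K) i \<omega>)))"

abbreviation levels :: "nat \<Rightarrow> nat \<Rightarrow> ('n \<Rightarrow> nat) set" where
  "levels m K \<equiv> {k \<in> PiE UNIV (\<lambda>_. {..K}). (\<Sum>j\<in>UNIV. e j * k j) > m}"

text \<open>
  By equidistribution the mean over the points is a multiple of the sum over all intervals of level
  \<open>k\<close>, which vanishes for every realization of the scramble.
\<close>

lemma component_mean_integrated_exactly:
  assumes \<omega>: "\<omega> \<in> space M" and k: "\<And>j. k j \<le> K" "k \<noteq> (\<lambda>_. 0)" and le: "(\<Sum>j\<in>UNIV. e j * k j) \<le> m"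
  shows "component_mean m K f k \<omega> = 0"
proof -
  have "(\<Sum>i<b ^ m. component c K f k (scrambled k i \<omega>))
      = real (b ^ (m - (\<Sum>j\<in>UNIV. e j * k j))) *
        (\<Sum>a\<in>PiE UNIV (\<lambda>j. {..<c j ^ k j}). component c K f k (scrambled_cells c (\<lambda>j w. P j w \<omega>) k a))"
    unfolding scrambled_def using b
    by (intro sum_over_net[OF net _ le, of "\<lambda>a. component c K f k (scrambled_cells c (\<lambda>j w. P j w \<omega>) k a)"]) simp
  also have "\<dots> = 0"
    using sum_scrambled_component[OF base_pos scramble_permutes[OF \<omega>] k(2,1)] by simp
  finally show ?thesis by (simp add: component_mean_def)
qed

text \<open>
  Coarse levels drop out, and level \<open>0\<close> contributes a constant, the mean over the whole grid.
\<close>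

lemma grid_mean_eq_sum_components:
  assumes \<omega>: "\<omega> \<in> space M"
  shows "grid_mean m K f \<omega> = component c K f (\<lambda>_. 0) (\<lambda>_. 0) + (\<Sum>k\<in>levels m K. component_mean m K f k \<omega>)"
proof -
  let ?Z = "PiE UNIV (\<lambda>_ :: 'n. {..K})"
  have fin: "finite ?Z" by (intro finite_PiE) auto
  have n: "real (b ^ m) > 0" using b by simp
  have "f (grid_point c K (scrambled (\<lambda>_. K) i \<omega>)) = (\<Sum>k\<in>?Z. component c K f k (scrambled k i \<omega>))" for i
  proof -
    have z: "scrambled (\<lambda>_. K) i \<omega> j < c j ^ K" for j
      using scrambled_less[OF \<omega>, of "\<lambda>_. K"] by simp
    have "f (grid_point c K (scrambled (\<lambda>_. K) i \<omega>))
        = (\<Sum>k\<in>?Z. component c K f k (\<lambda>j. scrambled (\<lambda>_. K) i \<omega> j div c j ^ (K - k j)))"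
      by (rule sum_components[where c = c, OF base_pos z, symmetric])
    also have "\<dots> = (\<Sum>k\<in>?Z. component c K f k (scrambled k i \<omega>))"
      by (intro sum.cong refl arg_cong[of _ _ "component c K f _"] scrambled_coarser[OF \<omega>, symmetric]) auto
    finally show ?thesis .
  qed
  then have "grid_mean m K f \<omega> = (\<Sum>k\<in>?Z. component_mean m K f k \<omega>)"
    unfolding grid_mean_def component_mean_def by (simp add: sum_distrib_left sum.swap[of _ ?Z])
  also have "\<dots> = (\<Sum>k\<in>insert (\<lambda>_. 0) (levels m K). component_mean m K f k \<omega>)"
  proof (rule sum.mono_neutral_right[OF fin])
    show "\<forall>k\<in>?Z - insert (\<lambda>_. 0) (levels m K). component_mean m K f k \<omega> = 0"
    proof
      fix k assume k: "k \<in> ?Z - insert (\<lambda>_. 0) (levels m K)"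
      show "component_mean m K f k \<omega> = 0"
        using k by (intro component_mean_integrated_exactly[OF \<omega>]) (auto simp: PiE_iff)
    qed
  qed auto
  also have "\<dots> = component_mean m K f (\<lambda>_. 0) \<omega> + (\<Sum>k\<in>levels m K. component_mean m K f k \<omega>)"
    using fin by (intro sum.insert) auto
  also have "component_mean m K f (\<lambda>_. 0) \<omega> = component c K f (\<lambda>_. 0) (\<lambda>_. 0)"
  proof -
    have "scrambled (\<lambda>_. 0) i \<omega> = (\<lambda>_. 0)" for i
      by (simp add: scrambled_def scrambled_cells_def)
    then show ?thesis using n by (simp add: component_mean_def)
  qed
  finally show ?thesis .
qed

lemma integrable_grid_mean_deviation:
  "integrable M (\<lambda>\<omega>. (grid_mean m K f \<omega> - t)\<^sup>2)"
proof -
  have "(grid_mean m K f \<omega> - t)\<^sup>2 = (\<Sum>i<b ^ m. \<Sum>i'<b ^ m. (1 / real (b ^ m))\<^sup>2 *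
      ((f (grid_point c K (scrambled (\<lambda>_. K) i \<omega>)) - t) * (f (grid_point c K (scrambled (\<lambda>_. K) i' \<omega>)) - t)))" for \<omega>
  proof -
    have "grid_mean m K f \<omega> - t = 1 / real (b ^ m) * (\<Sum>i<b ^ m. f (grid_point c K (scrambled (\<lambda>_. K) i \<omega>)) - t)"
      using b by (simp add: grid_mean_def sum_subtractf right_diff_distrib)
    then show ?thesis
      unfolding power2_eq_square by (simp add: sum_product sum_distrib_left mult_ac)
  qed
  then show ?thesis
    by (simp only:) (intro Bochner_Integration.integrable_sum integrable_mult_right
        integrable_scrambled[of "\<lambda>a. f (grid_point c K a) - t" _ _ "\<lambda>a. f (grid_point c K a) - t"])
qed

lemma grid_mean_second_moment:
  assumes \<beta>: "\<And>k a. (\<And>j. k j \<le> K) \<Longrightarrow> k \<noteq> (\<lambda>_. 0) \<Longrightarrow> (\<And>j. a j < c j ^ k j) \<Longrightarrow>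
      \<bar>component c K f k a\<bar> \<le> \<beta> k"
  shows "expectation (\<lambda>\<omega>. (grid_mean m K f \<omega> - component c K f (\<lambda>_. 0) (\<lambda>_. 0))\<^sup>2)
     \<le> real (b ^ (\<Sum>j\<in>UNIV. e j)) / real (b ^ m) * (\<Sum>k\<in>levels m K. (\<beta> k)\<^sup>2)"
proof -
  let ?Y = "component_mean m K f"
  have fin: "finite (levels m K)"
    by (rule finite_subset[of _ "PiE UNIV (\<lambda>_ :: 'n. {..K})"]) (auto intro: finite_PiE)
  have kK: "k j \<le> K" if "k \<in> levels m K" for k j using that by (auto simp: PiE_iff)
  have k0: "k \<noteq> (\<lambda>_. 0)" if "k \<in> levels m K" for k using that by auto
  have "expectation (\<lambda>\<omega>. (grid_mean m K f \<omega> - component c K f (\<lambda>_. 0) (\<lambda>_. 0))\<^sup>2)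
      = expectation (\<lambda>\<omega>. \<Sum>k\<in>levels m K. \<Sum>l\<in>levels m K. ?Y k \<omega> * ?Y l \<omega>)"
    by (intro Bochner_Integration.integral_cong refl)
       (simp add: grid_mean_eq_sum_components power2_eq_square sum_product)
  also have "\<dots> = (\<Sum>k\<in>levels m K. \<Sum>l\<in>levels m K. expectation (\<lambda>\<omega>. ?Y k \<omega> * ?Y l \<omega>))"
    by (simp add: Bochner_Integration.integral_sum integrable_component_mean_mult)
  also have "\<dots> = (\<Sum>k\<in>levels m K. expectation (\<lambda>\<omega>. ?Y k \<omega> * ?Y k \<omega>))"
  proof (rule sum.cong[OF refl])
    fix k assume k: "k \<in> levels m K"
    have "(\<Sum>l\<in>levels m K. expectation (\<lambda>\<omega>. ?Y k \<omega> * ?Y l \<omega>)) = (\<Sum>l\<in>{k}. expectation (\<lambda>\<omega>. ?Y k \<omega> * ?Y l \<omega>))"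
    proof (rule sum.mono_neutral_right[OF fin])
      show "\<forall>l\<in>levels m K - {k}. expectation (\<lambda>\<omega>. ?Y k \<omega> * ?Y l \<omega>) = 0"
      proof
        fix l assume l: "l \<in> levels m K - {k}"
        show "expectation (\<lambda>\<omega>. ?Y k \<omega> * ?Y l \<omega>) = 0"
          using l by (intro component_means_orthogonal kK[OF k] kK) auto
      qed
    qed (use k in auto)
    then show "(\<Sum>l\<in>levels m K. expectation (\<lambda>\<omega>. ?Y k \<omega> * ?Y l \<omega>)) = expectation (\<lambda>\<omega>. ?Y k \<omega> * ?Y k \<omega>)"
      by simp
  qed
  also have "\<dots> \<le> (\<Sum>k\<in>levels m K. real (b ^ (\<Sum>j\<in>UNIV. e j)) * (\<beta> k)\<^sup>2 / real (b ^ m))"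
  proof (rule sum_mono)
    fix k assume k: "k \<in> levels m K"
    then show "expectation (\<lambda>\<omega>. ?Y k \<omega> * ?Y k \<omega>) \<le> real (b ^ (\<Sum>j\<in>UNIV. e j)) * (\<beta> k)\<^sup>2 / real (b ^ m)"
      by (intro component_mean_second_moment[OF kK[OF k]] \<beta>[OF kK[OF k] k0[OF k]]) auto
  qed
  also have "\<dots> = real (b ^ (\<Sum>j\<in>UNIV. e j)) / real (b ^ m) * (\<Sum>k\<in>levels m K. (\<beta> k)\<^sup>2)"
    by (simp add: sum_distrib_left)
  finally show ?thesis .
qed

end

section \<open>Summation over the fine levels\<close>

text \<open>
  All entries of \<open>k\<close> are at most \<open>s\<close> because \<open>e\<^sub>j \<ge> 1\<close>, and one entry is determined by the others, so only
  \<open>d - 1\<close> of them are free.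
\<close>

lemma card_weighted_compositions:
  fixes e :: "'n::finite \<Rightarrow> nat"
  assumes e: "\<And>j. 1 \<le> e j"
  shows "finite {k. (\<Sum>j\<in>UNIV. e j * k j) = s}"
    and "card {k. (\<Sum>j\<in>UNIV. e j * k j) = s} \<le> (s + 1) ^ (CARD('n) - 1)"
proof -
  fix j0 :: 'n
  let ?A = "{k. (\<Sum>j\<in>UNIV. e j * k j) = s}" and ?U = "UNIV - {j0}"
  let ?B = "PiE ?U (\<lambda>_. {..s})"
  have le: "k j \<le> s" if "k \<in> ?A" for k j
  proof -
    have "1 * k j \<le> e j * k j" using e[of j] by (rule mult_right_mono) simp
    also have "\<dots> \<le> (\<Sum>j\<in>UNIV. e j * k j)" by (rule member_le_sum) auto
    finally show ?thesis using that by simp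
  qed
  have inj: "inj_on (\<lambda>k. restrict k ?U) ?A"
  proof (rule inj_onI)
    fix k k' assume k: "k \<in> ?A" "k' \<in> ?A" and eq: "restrict k ?U = restrict k' ?U"
    have off: "k j = k' j" if "j \<noteq> j0" for j using fun_cong[OF eq, of j] that by simp
    have "e j0 * k j0 + (\<Sum>j\<in>?U. e j * k j) = e j0 * k' j0 + (\<Sum>j\<in>?U. e j * k' j)"
      using k by (simp add: sum.remove[of UNIV j0])
    moreover have "(\<Sum>j\<in>?U. e j * k j) = (\<Sum>j\<in>?U. e j * k' j)" using off by (intro sum.cong) auto
    ultimately have "k j0 = k' j0" using e[of j0] by simp
    with off show "k = k'" by (metis ext)
  qed
  have into: "(\<lambda>k. restrict k ?U) ` ?A \<subseteq> ?B"
  proof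
    fix g assume "g \<in> (\<lambda>k. restrict k ?U) ` ?A"
    then obtain k where k: "k \<in> ?A" and g: "g = restrict k ?U" by blast
    show "g \<in> ?B" unfolding g restrict_PiE_iff using le[OF k] by simp
  qed
  have fB: "finite ?B" by (intro finite_PiE) auto
  show "finite ?A" using inj_on_finite[OF inj into fB] .
  have "card ?A \<le> card ?B" by (rule card_inj_on_le[OF inj into fB])
  also have "card ?B = (s + 1) ^ (CARD('n) - 1)" by (simp add: card_PiE card_Diff_singleton)
  finally show "card ?A \<le> (s + 1) ^ (CARD('n) - 1)" .
qed

lemma summable_polynomial_over_4_power: "summable (\<lambda>t. (real t + 2) ^ p / 4 ^ t)"
proof (rule summable_comparison_test')
  have "summable (\<lambda>t. fact p * exp 2 * (exp 1 / 4 :: real) ^ t)"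
  proof (intro summable_mult summable_geometric)
    have "exp (1::real) < 4" using exp_le by linarith
    then show "norm (exp 1 / 4 :: real) < 1" by simp
  qed
  then show "summable (\<lambda>t. fact p * exp 2 * (exp 1 / 4 :: real) ^ t)" .
  fix t :: nat
  have "(real t + 2) ^ p / fact p \<le> exp (real t + 2)"
  proof -
    have s: "(\<lambda>n. (real t + 2) ^ n /\<^sub>R fact n) sums exp (real t + 2)" by (rule exp_converges)
    have "(\<Sum>n\<in>{p}. (real t + 2) ^ n /\<^sub>R fact n) \<le> exp (real t + 2)"
      unfolding sums_unique[OF s] by (intro sum_le_suminf sums_summable[OF s]) auto
    then show ?thesis by (simp add: divide_inverse mult.commute)
  qed
  then have "(real t + 2) ^ p \<le> fact p * exp 2 * exp 1 ^ t"
    by (simp add: field_simps exp_add flip: exp_of_nat_mult)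
  then have "(real t + 2) ^ p / 4 ^ t \<le> fact p * exp 2 * exp 1 ^ t / 4 ^ t"
    by (rule divide_right_mono) simp
  then show "norm ((real t + 2) ^ p / 4 ^ t) \<le> fact p * exp 2 * (exp 1 / 4) ^ t"
    by (simp add: power_divide)
qed

text \<open>
  The sum is dominated by its first terms \<open>s = m + 1 + t\<close>: the geometric factor \<open>b\<^sup>-\<^sup>2\<^sup>t \<le> 4\<^sup>-\<^sup>t\<close> absorbs the
  growth of the counts, since \<open>m + 2 + t \<le> (m + 1) (t + 2)\<close> separates the variables.
\<close>

lemma sum_fine_levels_bound:
  fixes e :: "'n::finite \<Rightarrow> nat" and b :: nat
  assumes e: "\<And>j. 1 \<le> e j" and b: "2 \<le> b" and S: "finite S" "\<And>k. k \<in> S \<Longrightarrow> (\<Sum>j\<in>UNIV. e j * k j) > m"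
  shows "(\<Sum>k\<in>S. (1 / real b ^ (\<Sum>j\<in>UNIV. e j * k j))\<^sup>2)
     \<le> (\<Sum>t. (real t + 2) ^ (CARD('n) - 1) / 4 ^ t) * ((real m + 1) ^ (CARD('n) - 1) / (real b ^ m)\<^sup>2)"
proof -
  let ?s = "\<lambda>k. \<Sum>j\<in>UNIV. e j * k j" and ?p = "CARD('n) - 1"
  define N where "N = Suc (Max (insert 0 (?s ` S)))"
  have N: "?s k < m + 1 + N" if "k \<in> S" for k
    using Max_ge[of "insert 0 (?s ` S)" "?s k"] S(1) that by (simp add: N_def less_Suc_eq_le trans_le_add2 le_SucI)
  have "(\<Sum>k\<in>S. (1 / real b ^ ?s k)\<^sup>2) = (\<Sum>s\<in>?s ` S. \<Sum>k | k \<in> S \<and> ?s k = s. (1 / real b ^ ?s k)\<^sup>2)"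
    by (rule sum.image_gen[OF S(1)])
  also have "\<dots> \<le> (\<Sum>s\<in>?s ` S. (real s + 1) ^ ?p * (1 / real b ^ s)\<^sup>2)"
  proof (rule sum_mono)
    fix s
    have "card {k. k \<in> S \<and> ?s k = s} \<le> card {k. ?s k = s}"
      using card_weighted_compositions(1)[of e, OF e] by (intro card_mono) auto
    also have "\<dots> \<le> (s + 1) ^ ?p" by (rule card_weighted_compositions(2)[of e, OF e])
    finally have "real (card {k. k \<in> S \<and> ?s k = s}) \<le> real ((s + 1) ^ ?p)" by (simp only: of_nat_le_iff)
    then have "real (card {k. k \<in> S \<and> ?s k = s}) * (1 / real b ^ s)\<^sup>2 \<le> (real s + 1) ^ ?p * (1 / real b ^ s)\<^sup>2"
      by (intro mult_right_mono) (auto simp: add.commute)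
    moreover have "(\<Sum>k | k \<in> S \<and> ?s k = s. (1 / real b ^ ?s k)\<^sup>2) = (\<Sum>k | k \<in> S \<and> ?s k = s. (1 / real b ^ s)\<^sup>2)"
      by (intro sum.cong) auto
    ultimately show "(\<Sum>k | k \<in> S \<and> ?s k = s. (1 / real b ^ ?s k)\<^sup>2) \<le> (real s + 1) ^ ?p * (1 / real b ^ s)\<^sup>2"
      by simp
  qed
  also have "\<dots> \<le> (\<Sum>s\<in>{0 + (m + 1)..<N + (m + 1)}. (real s + 1) ^ ?p * (1 / real b ^ s)\<^sup>2)"
    using S(2) N by (intro sum_mono2) (fastforce simp: add_ac)+
  also have "\<dots> = (\<Sum>t\<in>{0..<N}. (real (t + (m + 1)) + 1) ^ ?p * (1 / real b ^ (t + (m + 1)))\<^sup>2)"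
    by (rule sum.shift_bounds_nat_ivl)
  also have "\<dots> \<le> (\<Sum>t\<in>{0..<N}. (real t + 2) ^ ?p / 4 ^ t * ((real m + 1) ^ ?p / (real b ^ m)\<^sup>2))"
  proof (rule sum_mono)
    fix t
    have "real (t + (m + 1)) + 1 \<le> (real t + 2) * (real m + 1)" by (simp add: algebra_simps)
    then have 1: "(real (t + (m + 1)) + 1) ^ ?p \<le> (real t + 2) ^ ?p * (real m + 1) ^ ?p"
      by (simp only: power_mult_distrib[symmetric]) (rule power_mono, simp_all)
    have "4 ^ t * (real b ^ m)\<^sup>2 \<le> (real b ^ (t + (m + 1)))\<^sup>2"
    proof -
      have "(4::real) ^ t = (2 ^ t)\<^sup>2" by (simp add: power2_eq_square flip: power_mult_distrib)
      then have "4 ^ t * (real b ^ m)\<^sup>2 = (2 ^ t * real b ^ m)\<^sup>2" by (simp add: power_mult_distrib)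
      also have "\<dots> \<le> (real b ^ (t + (m + 1)))\<^sup>2"
      proof (rule power_mono)
        have "2 ^ t * real b ^ m \<le> real b ^ t * real b ^ m"
          using b by (intro mult_right_mono power_mono) auto
        also have "\<dots> = real b ^ (t + m)" by (simp add: power_add)
        also have "\<dots> \<le> real b ^ (t + (m + 1))" using b by (intro power_increasing) auto
        finally show "2 ^ t * real b ^ m \<le> real b ^ (t + (m + 1))" .
      qed simp
      finally show ?thesis .
    qed
    then have 2: "(1 / real b ^ (t + (m + 1)))\<^sup>2 \<le> 1 / (4 ^ t * (real b ^ m)\<^sup>2)"
      using b by (simp add: power_divide frac_le)
    have "(real (t + (m + 1)) + 1) ^ ?p * (1 / real b ^ (t + (m + 1)))\<^sup>2
        \<le> ((real t + 2) ^ ?p * (real m + 1) ^ ?p) * (1 / (4 ^ t * (real b ^ m)\<^sup>2))"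
      by (intro mult_mono 1 2) auto
    then show "(real (t + (m + 1)) + 1) ^ ?p * (1 / real b ^ (t + (m + 1)))\<^sup>2
        \<le> (real t + 2) ^ ?p / 4 ^ t * ((real m + 1) ^ ?p / (real b ^ m)\<^sup>2)"
      by simp
  qed
  also have "\<dots> = (\<Sum>t\<in>{0..<N}. (real t + 2) ^ ?p / 4 ^ t) * ((real m + 1) ^ ?p / (real b ^ m)\<^sup>2)"
    by (simp only: sum_distrib_right)
  also have "\<dots> \<le> (\<Sum>t. (real t + 2) ^ ?p / 4 ^ t) * ((real m + 1) ^ ?p / (real b ^ m)\<^sup>2)"
    by (intro mult_right_mono sum_le_suminf summable_polynomial_over_4_power) auto
  finally show ?thesis .
qed

section \<open>From the grid to the cube\<close>

definition l1_lipschitz :: "real \<Rightarrow> (real ^ 'n::finite \<Rightarrow> real) \<Rightarrow> bool" where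
  "l1_lipschitz B f \<longleftrightarrow> (\<forall>x\<in>unit_cube. \<forall>y\<in>unit_cube. \<bar>f x - f y\<bar> \<le> B * (\<Sum>j\<in>UNIV. \<bar>x $ j - y $ j\<bar>))"

lemma l1_lipschitzD:
  "l1_lipschitz B f \<Longrightarrow> x \<in> unit_cube \<Longrightarrow> y \<in> unit_cube \<Longrightarrow> \<bar>f x - f y\<bar> \<le> B * (\<Sum>j\<in>UNIV. \<bar>x $ j - y $ j\<bar>)"
  by (simp add: l1_lipschitz_def)

text \<open>
  The partial derivatives of order one are bounded; \<open>x\<close> is moved to \<open>y\<close> one coordinate at a time.
\<close>

lemma mixed_partials_bounded_imp_l1_lipschitz:
  fixes f :: "real ^ 'n::{finite,linorder} \<Rightarrow> real"
  assumes f: "mixed_partials_bounded_by B f"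
  shows "l1_lipschitz B f"
  unfolding l1_lipschitz_def
proof (intro ballI)
  fix x y :: "real ^ 'n::{finite,linorder}" assume x: "x \<in> unit_cube" and y: "y \<in> unit_cube"
  have step: "\<bar>f (upd z j p) - f (upd z j q)\<bar> \<le> B * \<bar>p - q\<bar>"
    if z: "z \<in> unit_cube" and p: "0 \<le> p" "p < 1" and q: "0 \<le> q" "q < 1" for z j p q
  proof -
    have "\<exists>h. has_mixed_partial (sorted_list_of_set {j}) f h \<and> (\<forall>x\<in>unit_cube. \<bar>h x\<bar> \<le> B)"
      using f unfolding mixed_partials_bounded_by_def by (elim allE[of _ "{j}"] impE) auto
    then obtain h f' where f': "\<forall>x\<in>unit_cube. f' x = f x" and hB: "\<forall>x\<in>unit_cube. \<bar>h x\<bar> \<le> B"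
      and d: "\<forall>x\<in>unit_cube. ((\<lambda>t. f' (upd x j t)) has_real_derivative h x) (at (x $ j) within {0..<1})"
      by auto
    have "\<bar>f' (upd z j p) - f' (upd z j q)\<bar> \<le> B * \<bar>p - q\<bar>"
      using d hB by (intro has_mixed_partial_increment_bound[where g = h] z p q) auto
    then show ?thesis using f' upd_in_unit_cube[OF z] p q by simp
  qed
  have "\<bar>f x - f (\<chi> i. if i \<in> S then y $ i else x $ i)\<bar> \<le> B * (\<Sum>j\<in>S. \<bar>x $ j - y $ j\<bar>)" for S
    using finite[of S]
  proof (induction S rule: finite_induct)
    case (insert j S)
    let ?z = "\<chi> i. if i \<in> S then y $ i else x $ i"
    have z: "?z \<in> unit_cube" using x y by (simp add: unit_cube_def)
    have "?z = upd ?z j (x $ j)" using insert.hyps by (simp add: vec_eq_iff)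
    moreover have "(\<chi> i. if i \<in> insert j S then y $ i else x $ i) = upd ?z j (y $ j)"
      by (simp add: vec_eq_iff)
    ultimately have "\<bar>f ?z - f (\<chi> i. if i \<in> insert j S then y $ i else x $ i)\<bar> \<le> B * \<bar>x $ j - y $ j\<bar>"
      using step[OF z, of "x $ j" "y $ j" j] x y by (simp add: unit_cube_def)
    with insert show ?case by (simp add: distrib_left)
  qed simp
  from this[of UNIV] show "\<bar>f x - f y\<bar> \<le> B * (\<Sum>j\<in>UNIV. \<bar>x $ j - y $ j\<bar>)" by simp
qed

lemma l1_lipschitz_bounded:
  fixes f :: "real ^ 'n::finite \<Rightarrow> real"
  assumes "l1_lipschitz B f" "0 \<le> B" "x \<in> unit_cube"
  shows "\<bar>f x\<bar> \<le> \<bar>f 0\<bar> + B * CARD('n)"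
proof -
  have 0: "(0 :: real ^ 'n) \<in> unit_cube" by (simp add: unit_cube_def)
  have "(\<Sum>j\<in>UNIV. \<bar>x $ j - (0 :: real ^ 'n) $ j\<bar>) \<le> (\<Sum>j\<in>(UNIV :: 'n set). 1)"
    using assms(3) by (intro sum_mono) (simp add: unit_cube_def less_imp_le)
  then have "B * (\<Sum>j\<in>UNIV. \<bar>x $ j - (0 :: real ^ 'n) $ j\<bar>) \<le> B * CARD('n)"
    using assms(2) by (intro mult_left_mono) auto
  then show ?thesis using l1_lipschitzD[OF assms(1,3) 0] by linarith
qed

lemma l1_lipschitz_continuous:
  fixes f :: "real ^ 'n::finite \<Rightarrow> real"
  assumes "l1_lipschitz B f" "0 \<le> B"
  shows "continuous_on unit_cube f"
proof (rule lipschitz_on_continuous_on)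
  show "(B * CARD('n))-lipschitz_on unit_cube f"
  proof (rule lipschitz_onI)
    fix x y :: "real ^ 'n" assume xy: "x \<in> unit_cube" "y \<in> unit_cube"
    have "(\<Sum>j\<in>UNIV. \<bar>x $ j - y $ j\<bar>) \<le> (\<Sum>j\<in>(UNIV :: 'n set). dist x y)"
      using component_le_norm_cart[of "x - y"] by (intro sum_mono) (simp add: dist_norm)
    then have "B * (\<Sum>j\<in>UNIV. \<bar>x $ j - y $ j\<bar>) \<le> B * (CARD('n) * dist x y)"
      using assms(2) by (intro mult_left_mono) auto
    then show "dist (f x) (f y) \<le> B * CARD('n) * dist x y"
      using l1_lipschitzD[OF assms(1) xy] by (simp add: dist_real_def)
  qed (use assms(2) in simp)
qed

lemma unit_cube_borel: "(unit_cube :: (real ^ 'n::finite) set) \<in> sets borel"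
proof -
  have "(unit_cube :: (real ^ 'n) set) = (\<Inter>j. {x. 0 \<le> x $ j} \<inter> {x. x $ j < 1})"
    by (auto simp: unit_cube_def)
  also have "\<dots> \<in> sets borel"
    by (intro sets.finite_INT sets.Int borel_closed borel_open closed_Collect_le open_Collect_less
        continuous_intros) auto
  finally show ?thesis .
qed

lemma (in prob_space) variance_of_le:
  fixes X :: "'a \<Rightarrow> real"
  assumes "X \<in> borel_measurable M" "\<And>\<omega>. \<omega> \<in> space M \<Longrightarrow> \<bar>X \<omega>\<bar> \<le> A"
  shows "variance_of M X \<le> expectation (\<lambda>\<omega>. (X \<omega> - a)\<^sup>2)"
proof -
  let ?\<mu> = "expectation X"
  have X: "integrable M X" using assms by (intro integrable_const_bound[where B = A] AE_I2) auto
  have XX: "integrable M (\<lambda>\<omega>. (X \<omega>)\<^sup>2)"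
  proof (rule integrable_const_bound[where B = "A\<^sup>2"])
    show "AE \<omega> in M. norm ((X \<omega>)\<^sup>2) \<le> A\<^sup>2"
      using power_mono[OF assms(2), of _ 2] by (intro AE_I2) simp
  qed (use assms(1) in measurable)
  have *: "expectation (\<lambda>\<omega>. (X \<omega> - t)\<^sup>2) = expectation (\<lambda>\<omega>. (X \<omega>)\<^sup>2) - 2 * t * ?\<mu> + t\<^sup>2" for t
    using X XX by (simp add: power2_diff prob_space mult_ac)
  have "expectation (\<lambda>\<omega>. (X \<omega> - a)\<^sup>2) - variance_of M X = (?\<mu> - a)\<^sup>2"
    unfolding variance_of_def * by (simp add: power2_eq_square algebra_simps)
  then show ?thesis by (metis diff_ge_0_iff_ge zero_le_power2)
qed

context scrambled_net
begin

abbreviation scrambled_real :: "nat \<Rightarrow> 'w \<Rightarrow> real ^ 'n" where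
  "scrambled_real i \<omega> \<equiv> scrambled_point c P \<omega> (x i)"

lemma base_ge: "2 ^ K \<le> real (c j) ^ K"
proof -
  have "2 \<le> real (c j)" using base[of j] by (metis of_nat_le_iff of_nat_numeral)
  then show ?thesis by (intro power_mono) auto
qed

lemma scrambled_real_bounds:
  assumes \<omega>: "\<omega> \<in> space M"
  shows "real (scrambled (\<lambda>_. K) i \<omega> j) / real (c j) ^ K \<le> scrambled_real i \<omega> $ j"
    and "scrambled_real i \<omega> $ j \<le> (real (scrambled (\<lambda>_. K) i \<omega> j) + 1) / real (c j) ^ K"
proof -
  have c: "1 < c j" using base[of j] by simp
  have x: "0 \<le> x i $ j" using point_in_cube[of i] by (simp add: unit_cube_def)
  note * = nested_map_bounds[where k = K and p = "\<lambda>w. P j w \<omega>", OF c scramble_less[OF \<omega>] x]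
  show "real (scrambled (\<lambda>_. K) i \<omega> j) / real (c j) ^ K \<le> scrambled_real i \<omega> $ j"
    and "scrambled_real i \<omega> $ j \<le> (real (scrambled (\<lambda>_. K) i \<omega> j) + 1) / real (c j) ^ K"
    using * by (simp_all add: scrambled_point_def scrambled_def scrambled_cells_def cells_def)
qed

lemma grid_point_in_cube:
  assumes \<omega>: "\<omega> \<in> space M"
  shows "grid_point c K (scrambled (\<lambda>_. K) i \<omega>) \<in> unit_cube"
  unfolding unit_cube_def
proof (intro CollectI allI)
  fix j
  have "scrambled (\<lambda>_. K) i \<omega> j < c j ^ K" using scrambled_less[OF \<omega>, of "\<lambda>_. K"] by simp
  then have "real (scrambled (\<lambda>_. K) i \<omega> j) < real (c j) ^ K" by (metis of_nat_less_iff of_nat_power)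
  moreover have "0 < real (c j) ^ K" using base_pos by simp
  ultimately show "0 \<le> grid_point c K (scrambled (\<lambda>_. K) i \<omega>) $ j \<and> grid_point c K (scrambled (\<lambda>_. K) i \<omega>) $ j < 1"
    by (simp add: grid_point_def)
qed

text \<open>
  The indicator of the event that the first \<open>K\<close> scrambled digits are all \<open>c - 1\<close>. A scrambled coordinate can
  equal \<open>1\<close>, where the mean reads \<open>f\<close> as \<open>0\<close>, only on this event.
\<close>

definition top_cell :: "nat \<Rightarrow> nat \<Rightarrow> 'n \<Rightarrow> 'w \<Rightarrow> real" where
  "top_cell K i j \<omega> = (if scrambled (\<lambda>_. K) i \<omega> j = c j ^ K - 1 then 1 else 0)"

lemma top_cell_bounds: "0 \<le> top_cell K i j \<omega>" "top_cell K i j \<omega> \<le> 1"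
  by (simp_all add: top_cell_def)

lemma integrable_top_cell: "integrable M (top_cell K i j)"
  using integrable_scrambled[of "\<lambda>a. if a j = c j ^ K - 1 then 1 else 0" "\<lambda>_. K" i "\<lambda>_. 1" "\<lambda>_. K" i]
  by (simp add: top_cell_def[abs_def])

lemma expectation_top_cell: "expectation (top_cell K i j) \<le> 1 / 2 ^ K"
proof -
  have "expectation (top_cell K i j) \<le> 1 / real (c j) ^ K"
    unfolding top_cell_def[abs_def] scrambled_def scrambled_cells_def
    by (rule expectation_scramble_cell_eq_le)
  also have "\<dots> \<le> 1 / 2 ^ K" using base_ge[of K j] by (intro frac_le) auto
  finally show ?thesis .
qed

lemma grid_approximation:
  assumes \<omega>: "\<omega> \<in> space M" and f: "l1_lipschitz B f" "0 \<le> B"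
    and A: "\<And>y. y \<in> unit_cube \<Longrightarrow> \<bar>f y\<bar> \<le> A" "0 \<le> A"
  shows "\<bar>indicator unit_cube (scrambled_real i \<omega>) * f (scrambled_real i \<omega>)
      - f (grid_point c K (scrambled (\<lambda>_. K) i \<omega>))\<bar>
    \<le> B * CARD('n) / 2 ^ K + A * (\<Sum>j\<in>UNIV. top_cell K i j \<omega>)"
proof -
  let ?y = "scrambled_real i \<omega>" and ?N = "scrambled (\<lambda>_. K) i \<omega>"
  let ?g = "grid_point c K ?N"
  have g: "?g \<in> unit_cube" by (rule grid_point_in_cube[OF \<omega>])
  have T: "0 \<le> (\<Sum>j\<in>UNIV. top_cell K i j \<omega>)" by (intro sum_nonneg top_cell_bounds)
  show ?thesis
  proof (cases "?y \<in> unit_cube")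
    case True
    have "\<bar>?y $ j - ?g $ j\<bar> \<le> 1 / 2 ^ K" for j
    proof -
      have "\<bar>?y $ j - ?g $ j\<bar> \<le> 1 / real (c j) ^ K"
        using scrambled_real_bounds[where K = K and i = i and j = j, OF \<omega>] by (simp add: grid_point_def add_divide_distrib)
      also have "\<dots> \<le> 1 / 2 ^ K" using base_ge[of K j] by (intro frac_le) auto
      finally show ?thesis .
    qed
    then have "(\<Sum>j\<in>UNIV. \<bar>?y $ j - ?g $ j\<bar>) \<le> (\<Sum>j\<in>(UNIV :: 'n set). 1 / 2 ^ K)" by (intro sum_mono)
    then have "B * (\<Sum>j\<in>UNIV. \<bar>?y $ j - ?g $ j\<bar>) \<le> B * (CARD('n) / 2 ^ K)"
      using f(2) by (intro mult_left_mono) auto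
    moreover have "0 \<le> A * (\<Sum>j\<in>UNIV. top_cell K i j \<omega>)" using T A(2) by simp
    ultimately show ?thesis using l1_lipschitzD[OF f(1) True g] True by simp
  next
    case False
    have N: "?N j < c j ^ K" for j using scrambled_less[OF \<omega>, of "\<lambda>_. K"] by simp
    have cK: "0 < real (c j) ^ K" for j using base_pos by simp
    have "0 \<le> ?y $ j" for j
    proof -
      have "0 \<le> real (?N j) / real (c j) ^ K" by simp
      then show ?thesis using scrambled_real_bounds(1)[where K = K and i = i and j = j, OF \<omega>] by linarith
    qed
    with False obtain j where "1 \<le> ?y $ j" by (auto simp: unit_cube_def not_less)
    then have "1 \<le> (real (?N j) + 1) / real (c j) ^ K"
      using scrambled_real_bounds(2)[where K = K and i = i and j = j, OF \<omega>] by linarith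
    then have "real (c j) ^ K \<le> real (?N j) + 1" using cK[of j] by (simp add: le_divide_eq)
    then have "c j ^ K \<le> ?N j + 1" by (metis of_nat_1 of_nat_add of_nat_le_iff of_nat_power)
    then have "top_cell K i j \<omega> = 1" using N[of j] by (simp add: top_cell_def)
    then have "1 \<le> (\<Sum>j\<in>UNIV. top_cell K i j \<omega>)"
      using member_le_sum[of j UNIV "\<lambda>j. top_cell K i j \<omega>"] top_cell_bounds by simp
    then have "A * 1 \<le> A * (\<Sum>j\<in>UNIV. top_cell K i j \<omega>)" using A(2) by (rule mult_left_mono)
    moreover have "0 \<le> B * CARD('n) / 2 ^ K" using f(2) by simp
    ultimately show ?thesis using False A(1)[OF g] by simp
  qed
qed

lemma measurable_scrambled_real: "scrambled_real i \<in> borel_measurable M"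
proof (subst borel_measurable_euclidean_space, rule ballI)
  fix v :: "real ^ 'n" assume "v \<in> Basis"
  then obtain j where v: "v = axis j 1" by (auto simp: Basis_vec_def)
  let ?t = "x i $ j"
  have t: "0 \<le> ?t" using point_in_cube[of i] by (simp add: unit_cube_def)
  have "(\<lambda>\<omega>. nested_map (c j) (\<lambda>w. P j w \<omega>) ?t) \<in> borel_measurable M"
    unfolding nested_map_def
  proof (intro borel_measurable_suminf borel_measurable_divide borel_measurable_const)
    fix k
    let ?w = "map (\<lambda>i. digit (c j) i ?t) [1..<Suc k]"
    have "?w = word (c j) k (cell (c j) k ?t)" by (rule map_digit_eq_word[OF t base_pos])
    then have "(j, ?w) \<in> index" using set_word[OF base_pos, of j k] by (simp add: index_def)
    then have "integrable M (\<lambda>\<omega>. real (perm \<omega> (j, ?w) (digit (c j) (Suc k) ?t)))"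
      by (intro integrable_depends_on[of "{(j, ?w)}" "\<lambda>\<sigma>. real (\<sigma> (j, ?w) (digit (c j) (Suc k) ?t))"])
         (auto simp: depends_on_def)
    then show "(\<lambda>\<omega>. real (P j ?w \<omega> (digit (c j) (Suc k) ?t))) \<in> borel_measurable M"
      by (simp add: perm_def)
  qed
  then show "(\<lambda>\<omega>. scrambled_real i \<omega> \<bullet> v) \<in> borel_measurable M"
    by (simp add: v inner_axis scrambled_point_def)
qed

text \<open>
  The constant \<open>a\<close> is arbitrary, because the variance is the least mean square deviation from a constant. The two error
  terms come from the Lipschitz bound and from the points that may leave the cube; they vanish as
  \<open>K \<rightarrow> \<infinity>\<close> with \<open>m\<close> fixed.
\<close>

lemma variance_le_grid_deviation:
  fixes a :: real
  assumes f: "l1_lipschitz B f" "0 \<le> B"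
  shows "variance_of M (scrambled_mean c P x f (b ^ m))
    \<le> 2 * expectation (\<lambda>\<omega>. (grid_mean m K f \<omega> - a)\<^sup>2) + 4 * (B * CARD('n))\<^sup>2 / 4 ^ K
      + 4 * (\<bar>f 0\<bar> + B * CARD('n))\<^sup>2 * (real (b ^ m) * CARD('n))\<^sup>2 / 2 ^ K"
proof -
  let ?X = "scrambled_mean c P x f (b ^ m)" and ?R = "grid_mean m K f" and ?n = "b ^ m"
  define A where "A = \<bar>f 0\<bar> + B * CARD('n)"
  define \<delta> where "\<delta> = B * CARD('n) / 2 ^ K"
  define T where "T \<omega> = (\<Sum>i<?n. \<Sum>j\<in>UNIV. top_cell K i j \<omega>)" for \<omega>
  define D where "D = real ?n * CARD('n)"
  have A: "\<bar>f y\<bar> \<le> A" if "y \<in> unit_cube" for y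
    unfolding A_def by (rule l1_lipschitz_bounded[OF f that])
  have A0: "0 \<le> A" using f(2) by (simp add: A_def)
  have n: "1 \<le> real ?n" using b by (simp add: one_le_power)
  have T0: "0 \<le> T \<omega>" for \<omega> unfolding T_def by (intro sum_nonneg top_cell_bounds)
  have TD: "T \<omega> \<le> D" for \<omega>
  proof -
    have "T \<omega> \<le> (\<Sum>i<?n. \<Sum>j\<in>(UNIV :: 'n set). 1)" unfolding T_def by (intro sum_mono top_cell_bounds)
    then show ?thesis by (simp add: D_def)
  qed
  have intT: "integrable M T"
    unfolding T_def by (intro Bochner_Integration.integrable_sum integrable_top_cell)
  have ET: "expectation T \<le> D / 2 ^ K"
  proof -
    have "expectation T = (\<Sum>i<?n. \<Sum>j\<in>UNIV. expectation (top_cell K i j))"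
      unfolding T_def by (simp add: Bochner_Integration.integral_sum integrable_top_cell)
    also have "\<dots> \<le> (\<Sum>i<?n. \<Sum>j\<in>(UNIV :: 'n set). 1 / 2 ^ K)"
      by (intro sum_mono expectation_top_cell)
    finally show ?thesis by (simp add: D_def)
  qed
  have close: "\<bar>?X \<omega> - ?R \<omega>\<bar> \<le> \<delta> + A * T \<omega>" if \<omega>: "\<omega> \<in> space M" for \<omega>
  proof -
    let ?d = "\<lambda>i. indicator unit_cube (scrambled_real i \<omega>) * f (scrambled_real i \<omega>)
      - f (grid_point c K (scrambled (\<lambda>_. K) i \<omega>))"
    have "\<bar>\<Sum>i<?n. ?d i\<bar> \<le> (\<Sum>i<?n. \<delta> + A * (\<Sum>j\<in>UNIV. top_cell K i j \<omega>))"
      unfolding \<delta>_def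
      by (rule order_trans[OF sum_abs], rule sum_mono, rule grid_approximation[OF \<omega> f A A0])
    also have "\<dots> = real ?n * \<delta> + A * T \<omega>"
      by (simp add: sum.distrib T_def sum_distrib_left)
    finally have "\<bar>\<Sum>i<?n. ?d i\<bar> / real ?n \<le> (real ?n * \<delta> + A * T \<omega>) / real ?n"
      by (rule divide_right_mono) simp
    also have "\<dots> = \<delta> + A * T \<omega> / real ?n" using n b by (simp add: add_divide_distrib)
    also have "A * T \<omega> / real ?n \<le> A * T \<omega>"
      using n A0 T0[of \<omega>] mult_left_mono[OF n, of "A * T \<omega>"] by (simp add: divide_le_eq)
    finally have "\<bar>\<Sum>i<?n. ?d i\<bar> / real ?n \<le> \<delta> + A * T \<omega>" by simp
    moreover have "?X \<omega> - ?R \<omega> = (\<Sum>i<?n. ?d i) / real ?n"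
      by (simp add: scrambled_mean_def grid_mean_def sum_subtractf diff_divide_distrib)
    ultimately show ?thesis by simp
  qed
  have sq: "(?X \<omega> - a)\<^sup>2 \<le> 2 * (?R \<omega> - a)\<^sup>2 + (4 * \<delta>\<^sup>2 + 4 * A\<^sup>2 * D * T \<omega>)" if \<omega>: "\<omega> \<in> space M" for \<omega>
  proof -
    have two: "(s + t)\<^sup>2 \<le> 2 * s\<^sup>2 + 2 * t\<^sup>2" for s t :: real
      using zero_le_power2[of "s - t"] by (simp add: power2_sum power2_diff)
    have "(?X \<omega> - a)\<^sup>2 \<le> 2 * (?R \<omega> - a)\<^sup>2 + 2 * (?X \<omega> - ?R \<omega>)\<^sup>2"
      using two[of "?R \<omega> - a" "?X \<omega> - ?R \<omega>"] by simp
    also have "(?X \<omega> - ?R \<omega>)\<^sup>2 \<le> (\<delta> + A * T \<omega>)\<^sup>2"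
      using close[OF \<omega>] by (simp add: abs_le_square_iff[symmetric])
    also have "(\<delta> + A * T \<omega>)\<^sup>2 \<le> 2 * \<delta>\<^sup>2 + 2 * (A * T \<omega>)\<^sup>2" by (rule two)
    also have "(A * T \<omega>)\<^sup>2 \<le> A\<^sup>2 * (D * T \<omega>)"
      unfolding power_mult_distrib power2_eq_square[of "T \<omega>"]
      using T0[of \<omega>] TD[of \<omega>] by (intro mult_left_mono mult_right_mono) auto
    finally show ?thesis by simp
  qed
  have measX: "?X \<in> borel_measurable M"
  proof -
    have "(\<lambda>y. indicator unit_cube y *\<^sub>R f y) \<in> borel_measurable borel"
      by (rule borel_measurable_continuous_on_indicator[OF unit_cube_borel l1_lipschitz_continuous[OF f]])
    then have "(\<lambda>\<omega>. indicator unit_cube (scrambled_real i \<omega>) *\<^sub>R f (scrambled_real i \<omega>)) \<in> borel_measurable M" for i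
      using measurable_compose[OF measurable_scrambled_real] by blast
    then have "(\<lambda>\<omega>. \<Sum>i<?n. indicator unit_cube (scrambled_real i \<omega>) * f (scrambled_real i \<omega>)) \<in> borel_measurable M"
      by (intro borel_measurable_sum) simp
    from borel_measurable_times[OF borel_measurable_const this] show ?thesis
      unfolding scrambled_mean_def .
  qed
  have bndX: "\<bar>?X \<omega>\<bar> \<le> A" for \<omega>
  proof -
    have "\<bar>\<Sum>i<?n. indicator unit_cube (scrambled_real i \<omega>) * f (scrambled_real i \<omega>)\<bar> \<le> (\<Sum>i<?n. A)"
      by (rule order_trans[OF sum_abs], rule sum_mono) (auto simp: indicator_def A A0)
    then have "\<bar>\<Sum>i<?n. indicator unit_cube (scrambled_real i \<omega>) * f (scrambled_real i \<omega>)\<bar> \<le> A * real ?n"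
      by (simp add: mult.commute)
    then show ?thesis using n A0 by (simp add: scrambled_mean_def abs_mult divide_le_eq)
  qed
  have intX: "integrable M (\<lambda>\<omega>. (?X \<omega> - a)\<^sup>2)"
  proof (rule integrable_const_bound[where B = "(A + \<bar>a\<bar>)\<^sup>2"])
    have "\<bar>?X \<omega> - a\<bar> \<le> A + \<bar>a\<bar>" for \<omega> using bndX[of \<omega>] by linarith
    then have "norm ((?X \<omega> - a)\<^sup>2) \<le> (A + \<bar>a\<bar>)\<^sup>2" for \<omega>
      using A0 by (simp add: power2_le_iff_abs_le)
    then show "AE \<omega> in M. norm ((?X \<omega> - a)\<^sup>2) \<le> (A + \<bar>a\<bar>)\<^sup>2" by (intro AE_I2)
  qed (use measX in measurable)
  have "variance_of M ?X \<le> expectation (\<lambda>\<omega>. (?X \<omega> - a)\<^sup>2)"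
    by (rule variance_of_le[OF measX bndX])
  also have "\<dots> \<le> expectation (\<lambda>\<omega>. 2 * (?R \<omega> - a)\<^sup>2 + (4 * \<delta>\<^sup>2 + 4 * A\<^sup>2 * D * T \<omega>))"
    using integrable_grid_mean_deviation[of m K f a] intT sq
    by (intro integral_mono intX) auto
  also have "\<dots> = 2 * expectation (\<lambda>\<omega>. (?R \<omega> - a)\<^sup>2) + (4 * \<delta>\<^sup>2 + 4 * A\<^sup>2 * D * expectation T)"
    using integrable_grid_mean_deviation[of m K f a] intT by (simp add: prob_space)
  also have "\<dots> \<le> 2 * expectation (\<lambda>\<omega>. (?R \<omega> - a)\<^sup>2) + (4 * \<delta>\<^sup>2 + 4 * A\<^sup>2 * D * (D / 2 ^ K))"
    using ET by (intro add_left_mono mult_left_mono) (auto simp: D_def)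
  also have "4 * \<delta>\<^sup>2 = 4 * (B * CARD('n))\<^sup>2 / 4 ^ K"
  proof -
    have "((2::real) ^ K)\<^sup>2 = 4 ^ K" by (simp add: power2_eq_square flip: power_mult_distrib)
    then show ?thesis by (simp add: \<delta>_def power_divide)
  qed
  finally show ?thesis by (simp add: A_def D_def power2_eq_square mult_ac)
qed

lemma variance_le:
  fixes t :: real
  assumes f: "l1_lipschitz B f" "0 \<le> B"
    and grid: "\<And>K. \<exists>a. expectation (\<lambda>\<omega>. (grid_mean m K f \<omega> - a)\<^sup>2) \<le> t"
  shows "variance_of M (scrambled_mean c P x f (b ^ m)) \<le> 2 * t"
proof (rule LIMSEQ_le_const)
  let ?u = "4 * (B * CARD('n))\<^sup>2" and ?v = "4 * (\<bar>f 0\<bar> + B * CARD('n))\<^sup>2 * (real (b ^ m) * CARD('n))\<^sup>2"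
  have "(\<lambda>K. 2 * t + ?u * (1 / 4) ^ K + ?v * (1 / 2) ^ K) \<longlonglongrightarrow> 2 * t + ?u * 0 + ?v * 0"
    by (intro tendsto_intros LIMSEQ_power_zero) auto
  then show "(\<lambda>K. 2 * t + ?u / 4 ^ K + ?v / 2 ^ K) \<longlonglongrightarrow> 2 * t"
    by (simp add: power_one_over)
  have "variance_of M (scrambled_mean c P x f (b ^ m)) \<le> 2 * t + ?u / 4 ^ K + ?v / 2 ^ K" for K
  proof -
    from grid[of K] obtain a where "expectation (\<lambda>\<omega>. (grid_mean m K f \<omega> - a)\<^sup>2) \<le> t" ..
    then show ?thesis using variance_le_grid_deviation[OF f, of m K a] by linarith
  qed
  then show "\<exists>N. \<forall>K\<ge>N. variance_of M (scrambled_mean c P x f (b ^ m)) \<le> 2 * t + ?u / 4 ^ K + ?v / 2 ^ K"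
    by blast
qed

end

section \<open>The order of the variance\<close>

text \<open>
  A Lipschitz function on the bounded cube is bounded, so the derivative of top order joins the others
  under one bound.
\<close>

lemma mixed_partials_bounded:
  fixes f F :: "real ^ 'n::{finite,linorder} \<Rightarrow> real"
  assumes F: "has_mixed_partial (sorted_list_of_set UNIV) f F" and L: "L-lipschitz_on unit_cube F"
    and low: "bounded_lower_partials f"
  shows "\<exists>B\<ge>0. mixed_partials_bounded_by B f"
proof -
  have "\<exists>B. u \<noteq> {} \<longrightarrow> (\<exists>h. has_mixed_partial (sorted_list_of_set u) f h \<and> (\<forall>x\<in>unit_cube. \<bar>h x\<bar> \<le> B))" for u :: "'n set"
  proof (cases "u = {} \<or> u = UNIV")
    case True
    have "\<bar>F x\<bar> \<le> \<bar>F 0\<bar> + L * CARD('n)" if x: "x \<in> unit_cube" for x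
    proof -
      have "(0 :: real ^ 'n::{finite,linorder}) \<in> unit_cube" by (simp add: unit_cube_def)
      then have "dist (F x) (F 0) \<le> L * dist x 0" using lipschitz_onD[OF L x, of 0] by simp
      also have "dist x 0 \<le> (\<Sum>j\<in>UNIV. \<bar>x $ j\<bar>)" using norm_le_l1_cart[of x] by simp
      also have "\<dots> \<le> (\<Sum>j\<in>(UNIV :: 'n set). 1)"
        using x by (intro sum_mono) (simp add: unit_cube_def less_imp_le)
      finally show ?thesis using lipschitz_on_nonneg[OF L] by (simp add: mult_left_mono dist_real_def)
    qed
    then show ?thesis using F True by auto
  next
    case False
    then have "\<exists>g. has_mixed_partial (sorted_list_of_set u) f g \<and> bounded (g ` unit_cube)"
      using low unfolding bounded_lower_partials_def by simp
    then obtain g where "has_mixed_partial (sorted_list_of_set u) f g" "bounded (g ` unit_cube)" by (elim exE conjE)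
    then show ?thesis by (auto simp: bounded_iff)
  qed
  then obtain \<beta> where \<beta>: "\<And>u. u \<noteq> {} \<Longrightarrow>
      \<exists>h. has_mixed_partial (sorted_list_of_set u) f h \<and> (\<forall>x\<in>unit_cube. \<bar>h x\<bar> \<le> \<beta> u)" by metis
  have "mixed_partials_bounded_by (\<Sum>u\<in>UNIV. \<bar>\<beta> u\<bar>) f"
    unfolding mixed_partials_bounded_by_def
  proof (intro allI impI)
    fix u :: "'n set" assume "u \<noteq> {}"
    from \<beta>[OF this] obtain h where h: "has_mixed_partial (sorted_list_of_set u) f h" "\<forall>x\<in>unit_cube. \<bar>h x\<bar> \<le> \<beta> u" by (elim exE conjE)
    have "\<beta> u \<le> \<bar>\<beta> u\<bar>" by simp
    also have "\<dots> \<le> (\<Sum>u\<in>UNIV. \<bar>\<beta> u\<bar>)" by (rule member_le_sum) auto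
    finally have "\<forall>x\<in>unit_cube. \<bar>h x\<bar> \<le> (\<Sum>u\<in>UNIV. \<bar>\<beta> u\<bar>)" using h(2) by force
    with h(1) show "\<exists>h. has_mixed_partial (sorted_list_of_set u) f h \<and> (\<forall>x\<in>unit_cube. \<bar>h x\<bar> \<le> (\<Sum>u\<in>UNIV. \<bar>\<beta> u\<bar>))" by blast
  qed
  then show ?thesis by (intro exI[of _ "\<Sum>u\<in>UNIV. \<bar>\<beta> u\<bar>"]) (simp add: sum_nonneg)
qed

theorem corollary4p3:
  fixes b :: nat
    and e :: "'n::{finite,linorder} \<Rightarrow> nat"
    and x :: "nat \<Rightarrow> real ^ 'n::{finite,linorder}"
    and f F :: "real ^ 'n::{finite,linorder} \<Rightarrow> real"
    and M :: "'w measure"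
    and P :: "'n::{finite,linorder} \<Rightarrow> nat list \<Rightarrow> 'w \<Rightarrow> nat \<Rightarrow> nat"
    and L :: real
  assumes "b \<ge> 2"
    and "\<And>j. e j \<ge> 1"
    and "zero_e_sequence b e x"
    and "f \<in> borel_measurable (lebesgue_on unit_cube)"
    and "integrable (lebesgue_on unit_cube) (\<lambda>y. (f y)\<^sup>2)"
    and "has_mixed_partial (sorted_list_of_set UNIV) f F"
    and "L-lipschitz_on unit_cube F"
    and "bounded_lower_partials f"
    and "nested_scramble M (\<lambda>j. b ^ e j) P"
    and "two_fold_uniform M (\<lambda>j. b ^ e j) P"
  shows "(\<lambda>m. variance_of M (scrambled_mean (\<lambda>j. b ^ e j) P x f (b ^ m)))
           \<in> O(\<lambda>m. (ln (real (b ^ m))) ^ (CARD('n::{finite,linorder}) - 1) / real (b ^ m) ^ 3)"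
proof -
  have base: "2 \<le> b ^ e j" for j
    using assms(1) assms(2)[of j] power_increasing[of 1 "e j" b] by simp
  interpret prob_space M using assms(9) by (simp add: nested_scramble_def)
  interpret scrambled_net M b e P x
    by unfold_locales (use base assms in auto)
  let ?p = "CARD('n) - 1" and ?h = "real (b ^ (\<Sum>j\<in>UNIV. e j))"
  from mixed_partials_bounded[OF assms(6-8)] obtain B where B: "0 \<le> B" and f: "mixed_partials_bounded_by B f" by blast
  define Q where "Q = (\<Prod>j\<in>UNIV. 2 * real (c j))"
  define S where "S = (\<Sum>t. (real t + 2) ^ ?p / 4 ^ t)"
  have second_moment: "expectation (\<lambda>\<omega>. (grid_mean m K f \<omega> - component c K f (\<lambda>_. 0) (\<lambda>_. 0))\<^sup>2)
      \<le> ?h * (B * Q)\<^sup>2 * S * (real m + 1) ^ ?p / real (b ^ m) ^ 3" for m K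
  proof -
    have fin: "finite (levels m K)"
      by (rule finite_subset[of _ "PiE UNIV (\<lambda>_ :: 'n. {..K})"]) (auto intro: finite_PiE)
    have "expectation (\<lambda>\<omega>. (grid_mean m K f \<omega> - component c K f (\<lambda>_. 0) (\<lambda>_. 0))\<^sup>2)
        \<le> ?h / real (b ^ m) * (\<Sum>k\<in>levels m K. (B * (\<Prod>j\<in>UNIV. 2 * real (c j) / real (c j) ^ k j))\<^sup>2)"
      by (rule grid_mean_second_moment) (rule component_bound[OF f B base_pos])
    also have "(\<Sum>k\<in>levels m K. (B * (\<Prod>j\<in>UNIV. 2 * real (c j) / real (c j) ^ k j))\<^sup>2)
        = (B * Q)\<^sup>2 * (\<Sum>k\<in>levels m K. (1 / real b ^ (\<Sum>j\<in>UNIV. e j * k j))\<^sup>2)"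
    proof -
      have "(\<Prod>j\<in>UNIV. 2 * real (c j) / real (c j) ^ k j) = Q * (1 / real b ^ (\<Sum>j\<in>UNIV. e j * k j))" for k
        by (simp add: prod_dividef Q_def power_mult power_sum)
      then have "(B * (\<Prod>j\<in>UNIV. 2 * real (c j) / real (c j) ^ k j))\<^sup>2
          = (B * Q)\<^sup>2 * (1 / real b ^ (\<Sum>j\<in>UNIV. e j * k j))\<^sup>2" for k
        by (simp only: mult.assoc[symmetric] power_mult_distrib)
      then show ?thesis by (simp only: sum_distrib_left)
    qed
    also have "?h / real (b ^ m) * ((B * Q)\<^sup>2 * (\<Sum>k\<in>levels m K. (1 / real b ^ (\<Sum>j\<in>UNIV. e j * k j))\<^sup>2))
        \<le> ?h / real (b ^ m) * ((B * Q)\<^sup>2 * (S * ((real m + 1) ^ ?p / (real b ^ m)\<^sup>2)))"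
      unfolding S_def using assms(1,2)
      by (intro mult_left_mono sum_fine_levels_bound fin) auto
    also have "\<dots> = ?h * (B * Q)\<^sup>2 * S * (real m + 1) ^ ?p / real (b ^ m) ^ 3"
      by (simp add: power2_eq_square power3_eq_cube)
    finally show ?thesis .
  qed
  let ?V = "\<lambda>m. variance_of M (scrambled_mean c P x f (b ^ m))"
  define C where "C = 2 * (?h * (B * Q)\<^sup>2 * S)"
  have V: "?V m \<le> C * (real m + 1) ^ ?p / real (b ^ m) ^ 3" for m
  proof -
    have "?V m \<le> 2 * (?h * (B * Q)\<^sup>2 * S * (real m + 1) ^ ?p / real (b ^ m) ^ 3)"
      using second_moment by (intro variance_le[OF mixed_partials_bounded_imp_l1_lipschitz[OF f] B]) blast
    then show ?thesis by (simp add: C_def)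
  qed
  have S0: "0 \<le> S" unfolding S_def by (intro suminf_nonneg summable_polynomial_over_4_power) simp
  then have C0: "0 \<le> C" by (simp add: C_def)
  have lnb: "0 < ln (real b)" using assms(1) by simp
  show ?thesis
  proof (rule bigoI[where c = "C * (2 / ln (real b)) ^ ?p"])
    show "\<forall>\<^sub>F m in at_top. norm (?V m) \<le> C * (2 / ln (real b)) ^ ?p * norm ((ln (real (b ^ m))) ^ ?p / real (b ^ m) ^ 3)"
      using eventually_ge_at_top[of 1]
    proof eventually_elim
      case (elim m)
      have V0: "0 \<le> ?V m" unfolding variance_of_def by (rule Bochner_Integration.integral_nonneg) simp
      have "(real m + 1) ^ ?p \<le> (2 * real m) ^ ?p" using elim by (intro power_mono) auto
      also have "2 * real m = 2 / ln (real b) * ln (real (b ^ m))"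
        using lnb by (simp add: ln_realpow)
      finally have "C * (real m + 1) ^ ?p / real (b ^ m) ^ 3
          \<le> C * (2 / ln (real b) * ln (real (b ^ m))) ^ ?p / real (b ^ m) ^ 3"
        using C0 by (intro divide_right_mono mult_left_mono) auto
      also have "\<dots> = C * (2 / ln (real b)) ^ ?p * ((ln (real (b ^ m))) ^ ?p / real (b ^ m) ^ 3)"
        by (simp only: power_mult_distrib times_divide_eq_right mult.assoc)
      also have "(ln (real (b ^ m))) ^ ?p / real (b ^ m) ^ 3 = norm ((ln (real (b ^ m))) ^ ?p / real (b ^ m) ^ 3)"
      proof -
        have "0 \<le> ln (real (b ^ m))" using assms(1) by (simp add: ln_realpow)
        then have "0 \<le> (ln (real (b ^ m))) ^ ?p / real (b ^ m) ^ 3" by simp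
        then show ?thesis by (simp only: real_norm_def abs_of_nonneg)
      qed
      finally show ?case using V[of m] V0 by simp
    qed
  qed
qed

end
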